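(* Let $X=[-\pi,\pi]$ with Lebesgue measure and let $\psi\in U\Psi$ with $\operatorname{supp}\psi\supset(1,\infty)$. Put $\psi_{1,1}(p)=p^2\psi(p)/(p-1)$. Then $$\sup_{M\ge1}\|s_M\|[G(\psi)\to G(\psi_{1,1})]<\infty,$$ that is, there is a constant $C<\infty$ such that $\|s_M[f]\|G(\psi_{1,1})\le C\|f\|G(\psi)$ for all $M\ge1$ and all $f\in G(\psi)$.
   Context: $|f|_p=\left(\int_{-\pi}^{\pi}|f(x)|^p\,dx\right)^{1/p}$. For $1\le a<b\le\infty$, $U\Psi=U\Psi(a,b)$ is the set of positive continuous functions on $(a,b)$; as a standing assumption, $\psi(a+0)=\infty$ or $\psi(b-0)=\infty$. $\operatorname{supp}\psi=\{p:\psi(p)<\infty\}$; here the interval is $(a,b)=(1,\infty)$. For such a function $\psi$, $G(\psi)$ is the space of all measurable $f$ with finite norm $\|f\|G(\psi)=\sup_{p\in(a,b)}|f|_p/\psi(p)$. The Fourier coefficients are $c(n)=\int_{-\pi}^{\pi}\exp(inx)f(x)\,dx$, $n\in\mathbb{Z}$, and the partial sums $s_M[f]$ are given by $2\pi s_M[f](x)=\sum_{|n|\le M}c(n)\exp(-inx)$. *)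

theory Defs
  imports "HOL-Analysis.Analysis"
begin

text \<open>Only meant for exponents \<^term>\<open>r > 0\<close>.\<close>

definition ennreal_powr :: "ennreal \<Rightarrow> real \<Rightarrow> ennreal" where
  "ennreal_powr x r = (if x = \<infinity> then \<infinity> else ennreal (enn2real x powr r))"

definition X_space :: "real measure" where
  "X_space = lebesgue_on {-pi..pi}"

definition Lp_norm :: "real \<Rightarrow> (real \<Rightarrow> complex) \<Rightarrow> ennreal" where
  "Lp_norm p f = ennreal_powr (\<integral>\<^sup>+x. ennreal (cmod (f x) powr p) \<partial>X_space) (1 / p)"

text \<open>
  The functions \<open>\<psi>\<close> take values in \<open>[0, \<infinity>]\<close>, so that the support condition \<open>\<psi> p < \<infinity>\<close> is
  meaningful. The conditions \<open>\<psi>(a+0) = \<infinity>\<close> and \<open>\<psi>(b-0) = \<infinity>\<close> are one-sided limits of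
  \<open>\<psi>\<close>; the endpoints are extended reals, and at \<open>b = \<infinity>\<close> the limit is the one for
  \<open>p \<rightarrow> \<infinity>\<close> (see \<open>ereal_tendsto_simps\<close>).
\<close>

definition U_Psi :: "ereal \<Rightarrow> ereal \<Rightarrow> (real \<Rightarrow> ennreal) set" where
  "U_Psi a b = {\<psi>. (\<forall>p\<in>einterval a b. 0 < \<psi> p) \<and> continuous_on (einterval a b) \<psi> \<and>
     (((\<psi> \<circ> real_of_ereal) \<longlongrightarrow> \<infinity>) (at_right a) \<or> ((\<psi> \<circ> real_of_ereal) \<longlongrightarrow> \<infinity>) (at_left b))}"

definition supp_Psi :: "(real \<Rightarrow> ennreal) \<Rightarrow> real set" where
  "supp_Psi \<psi> = {p. \<psi> p < \<infinity>}"

definition G_norm :: "ereal \<Rightarrow> ereal \<Rightarrow> (real \<Rightarrow> ennreal) \<Rightarrow> (real \<Rightarrow> complex) \<Rightarrow> ennreal" where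
  "G_norm a b \<psi> f = (SUP p\<in>einterval a b. Lp_norm p f / \<psi> p)"

definition G_space :: "ereal \<Rightarrow> ereal \<Rightarrow> (real \<Rightarrow> ennreal) \<Rightarrow> (real \<Rightarrow> complex) set" where
  "G_space a b \<psi> = {f \<in> borel_measurable X_space. G_norm a b \<psi> f < \<infinity>}"

text \<open>
  Functions are not identified almost everywhere. Since \<open>0 / 0 = 0\<close> and \<open>x / 0 = \<infinity>\<close> for
  \<open>x > 0\<close> in \<^typ>\<open>ennreal\<close>, an \<open>f\<close> of norm \<open>0\<close> contributes nothing to the supremum
  below exactly when \<open>T f\<close> has norm \<open>0\<close> as well.
\<close>

definition G_op_norm :: "ereal \<Rightarrow> ereal \<Rightarrow> (real \<Rightarrow> ennreal) \<Rightarrow> (real \<Rightarrow> ennreal) \<Rightarrow>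
    ((real \<Rightarrow> complex) \<Rightarrow> real \<Rightarrow> complex) \<Rightarrow> ennreal" where
  "G_op_norm a b \<psi> \<phi> T = (SUP f\<in>G_space a b \<psi>. G_norm a b \<phi> (T f) / G_norm a b \<psi> f)"

text \<open>
  The Fourier coefficients are not normalised and have kernel \<open>exp (i n x)\<close>; the factor
  \<open>1 / (2 \<pi>)\<close> and the kernel \<open>exp (- i n x)\<close> appear in the partial sums.
\<close>

definition fourier_coeff :: "(real \<Rightarrow> complex) \<Rightarrow> int \<Rightarrow> complex" where
  "fourier_coeff f n = (LINT x|X_space. exp (\<i> * of_int n * of_real x) * f x)"

definition fourier_partial_sum :: "nat \<Rightarrow> (real \<Rightarrow> complex) \<Rightarrow> real \<Rightarrow> complex" where
  "fourier_partial_sum M f x =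
     (\<Sum>n\<in>{- int M..int M}. fourier_coeff f n * exp (- (\<i> * of_int n * of_real x))) / (2 * of_real pi)"

definition psi_11 :: "(real \<Rightarrow> ennreal) \<Rightarrow> real \<Rightarrow> ennreal" where
  "psi_11 \<psi> p = ennreal (p\<^sup>2) * \<psi> p / ennreal (p - 1)"

end

theory Submission
  imports Defs
begin

text \<open>
  The theorem rests on M. Riesz's inequality for the partial sums of a Fourier series with a constant
  of the right growth at both ends of the range of exponents:
  \<open>|s_M[f]|_p \<le> 16 p\<^sup>2 / (p - 1) |f|_p\<close> for all \<open>1 < p < \<infinity>\<close> and all \<open>M\<close>. Dividing
  by \<open>p\<^sup>2 \<psi>(p) / (p - 1)\<close> and taking the supremum over \<open>p\<close> turns this into the bound \<open>16\<close> for
  the operator norm from \<open>G(\<psi>)\<close> to \<open>G(\<psi>\<^sub>1\<^sub>1)\<close>.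

  The core is an \<open>L\<^sup>q\<close> bound for the analytic part of a trigonometric polynomial when
  \<open>1 < q \<le> 2\<close> (\<open>riesz_projection\<close>), by a variant of P. Stein's argument. Write the polynomial as
  \<open>f = G + cnj H\<close> with \<open>G\<close>, \<open>H\<close> analytic and \<open>H(0) = 0\<close>. Both \<open>|f|\<^sup>2\<close> and \<open>|G|\<^sup>2 + |H|\<^sup>2\<close> have
  Laplacian \<open>4 (|G'|\<^sup>2 + |H'|\<^sup>2)\<close>, and \<open>|f|\<^sup>2 \<le> 2 (|G|\<^sup>2 + |H|\<^sup>2)\<close>. Since \<open>q \<le> 2\<close>, the power \<open>q / 2\<close>
  is concave, so that the Laplacian of \<open>(|G|\<^sup>2 + |H|\<^sup>2)\<^bsup>q/2\<^esup>\<close> is at most \<open>2 / (q - 1)\<close> times that of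
  \<open>(|f|\<^sup>2)\<^bsup>q/2\<^esup>\<close>. Hence \<open>2 / (q - 1) |f|\<^sup>q - (|G|\<^sup>2 + |H|\<^sup>2)\<^bsup>q/2\<^esup>\<close> is subharmonic (after adding a small
  \<open>e > 0\<close> under the powers), it is nonnegative at \<open>0\<close>, and so its mean over the unit circle is
  nonnegative: \<open>\<integral> |G|\<^sup>q \<le> 2 / (q - 1) \<integral> |f|\<^sup>q\<close>.

  After a modulation, a partial sum is the difference of two such analytic parts. This gives
  \<open>\<integral> |s_M[g]|\<^sup>q \<le> 16 / (q - 1) \<integral> |g|\<^sup>q\<close> for Laurent polynomials \<open>g\<close> in \<open>e\<^bsup>ix\<^esup>\<close>, and by
  uniform approximation for continuous periodic \<open>g\<close>. As \<open>s_M\<close> is symmetric for the pairing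
  \<open>\<integral> f g\<close>, Hoelder's inequality transfers a bound from \<open>L\<^sup>q\<close> to the dual exponent \<open>p\<close>
  (\<open>fourier_partial_sum_duality\<close>). The dual function \<open>cnj (s_M[f]) |s_M[f]|\<^bsup>p-2\<^esup>\<close> is continuous even
  if \<open>f\<close> is merely in \<open>L\<^sup>p\<close>, so the transfer also removes the continuity assumption: one use yields
  all \<open>p \<ge> 2\<close>, with a constant of order \<open>p\<close>, and a second one returns to \<open>1 < p \<le> 2\<close> with a
  constant of order \<open>1 / (p - 1)\<close>, now for every \<open>f\<close> in \<open>L\<^sup>p\<close>.
\<close>

section \<open>Circular means of subharmonic functions\<close>

text \<open>
  The mean value inequality in logarithmic polar coordinates: \<open>W t x\<close> stands for the value of a
  function at \<open>e\<^bsup>t+ix\<^esup>\<close>, \<open>V\<close> for its derivative in \<open>x\<close>, and \<open>L\<close> for \<open>2 \<pi>\<close> times its value at the origin. The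
  derivative of \<open>V\<close> integrates to \<open>0\<close> over a period, so subharmonicity makes
  \<open>t \<mapsto> \<integral> W t\<close> convex; a convex function with a finite limit at \<open>-\<infinity>\<close> is nondecreasing.
\<close>

lemma circle_mean_ge_limit:
  fixes W Wt Wtt V Vx :: "real \<Rightarrow> real \<Rightarrow> real"
  assumes Wt: "\<And>t x. ((\<lambda>t. W t x) has_real_derivative Wt t x) (at t)"
    and Wtt: "\<And>t x. ((\<lambda>t. Wt t x) has_real_derivative Wtt t x) (at t)"
    and Vx: "\<And>t x. (V t has_real_derivative Vx t x) (at x)"
    and per: "\<And>t. V t pi = V t (- pi)"
    and contW: "\<And>t. continuous_on UNIV (W t)"
    and contWt: "continuous_on UNIV (\<lambda>(t, x). Wt t x)"
    and contWtt: "continuous_on UNIV (\<lambda>(t, x). Wtt t x)"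
    and subharmonic: "\<And>t x. 0 \<le> Wtt t x + Vx t x"
    and lim: "((\<lambda>t. integral {-pi..pi} (W t)) \<longlongrightarrow> L) at_bot"
  shows "L \<le> integral {-pi..pi} (W 0)"
proof -
  define m where "m t = integral {-pi..pi} (W t)" for t
  define m1 where "m1 t = integral {-pi..pi} (Wt t)" for t
  define m2 where "m2 t = integral {-pi..pi} (Wtt t)" for t
  have cWt: "continuous_on A (Wt t)" and cWtt: "continuous_on A (Wtt t)" for t A
    by (rule continuous_on_compose2[OF contWt, of _ "\<lambda>x. (t, x)", simplified], intro continuous_intros)
       (rule continuous_on_compose2[OF contWtt, of _ "\<lambda>x. (t, x)", simplified], intro continuous_intros)
  have m1: "(m has_real_derivative m1 t) (at t)" for t
    unfolding m_def m1_def
    by (rule leibniz_rule_field_derivative[where U=UNIV and a="-pi" and b=pi, simplified])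
       (use Wt contWt contW in \<open>auto intro!: integrable_continuous_real intro: continuous_on_subset\<close>)
  have m2: "(m1 has_real_derivative m2 t) (at t)" for t
    unfolding m1_def m2_def
    by (rule leibniz_rule_field_derivative[where U=UNIV and a="-pi" and b=pi, simplified])
       (use Wtt contWtt cWt in \<open>auto intro!: integrable_continuous_real intro: continuous_on_subset\<close>)
  have m2_nonneg: "0 \<le> m2 t" for t
  proof -
    have "(Vx t has_integral V t pi - V t (- pi)) {-pi..pi}"
      by (rule fundamental_theorem_of_calculus)
         (auto intro!: has_real_derivative_iff_has_vector_derivative[THEN iffD1]
            has_field_derivative_at_within[OF Vx])
    moreover have "(Wtt t has_integral m2 t) {-pi..pi}"
      unfolding m2_def by (intro integrable_integral integrable_continuous_real cWtt)
    ultimately have "((\<lambda>x. Wtt t x + Vx t x) has_integral m2 t) {-pi..pi}"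
      using has_integral_add[of "Wtt t" "m2 t" _ "Vx t" 0] per by simp
    then show ?thesis
      using subharmonic by (rule has_integral_nonneg)
  qed
  have m1_mono: "m1 s \<le> m1 t" if "s \<le> t" for s t
    by (rule DERIV_nonneg_imp_nondecreasing[OF that]) (use m2 m2_nonneg in blast)
  have m1_nonneg: "0 \<le> m1 s" for s
  proof (rule ccontr)
    assume "\<not> 0 \<le> m1 s"
    then have neg: "m1 s < 0" by simp
    \<comment> \<open>A negative slope at \<open>s\<close> persists to the left, so \<open>m\<close> would be unbounded there.\<close>
    have "m s + m1 s * (t - s) \<le> m t" if "t \<le> s" for t
    proof -
      have "m s - m1 s * s \<le> m t - m1 s * t"
      proof (rule DERIV_nonpos_imp_nonincreasing[OF that])
        fix x assume "t \<le> x" "x \<le> s"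
        then show "\<exists>y. ((\<lambda>t. m t - m1 s * t) has_real_derivative y) (at x) \<and> y \<le> 0"
          using m1_mono[of x s] by (intro exI[of _ "m1 x - m1 s"]) (auto intro!: derivative_eq_intros m1)
      qed
      then show ?thesis by (simp add: algebra_simps)
    qed
    then have "eventually (\<lambda>t. m s + m1 s * (t - s) \<le> m t) at_bot"
      by (auto simp: eventually_at_bot_linorder)
    moreover have "filterlim (\<lambda>t. m s + m1 s * (t - s)) at_top at_bot"
    proof -
      have "filterlim (\<lambda>t. s + - t) at_top at_bot"
        by (intro filterlim_tendsto_add_at_top[OF tendsto_const] filterlim_uminus_at_top_at_bot)
      then have "filterlim (\<lambda>t. - m1 s * (s + - t)) at_top at_bot"
        using neg by (intro filterlim_tendsto_pos_mult_at_top[OF tendsto_const]) auto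
      then have "filterlim (\<lambda>t. m1 s * (t - s)) at_top at_bot"
        by (simp add: algebra_simps)
      then show ?thesis by (intro filterlim_tendsto_add_at_top[OF tendsto_const])
    qed
    ultimately have "filterlim m at_top at_bot"
      using filterlim_at_top_mono by blast
    then show False
      using lim not_tendsto_and_filterlim_at_infinity[of at_bot m L]
      unfolding m_def by (auto intro: filterlim_at_top_imp_at_infinity)
  qed
  have "m t \<le> m 0" if "t \<le> 0" for t
    by (rule DERIV_nonneg_imp_nondecreasing[OF that]) (use m1 m1_nonneg in blast)
  then have "eventually (\<lambda>t. m t \<le> m 0) at_bot"
    by (auto simp: eventually_at_bot_linorder)
  then show ?thesis
    using tendsto_upperbound[OF lim] unfolding m_def by auto
qed

section \<open>Powers of the norm of a harmonic map\<close>

text \<open>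
  \<open>reg_pow r e f\<close> stands for \<open>|f|\<^bsup>2r\<^esup>\<close>; the shift by \<open>e\<close> makes it smooth at the zeros of \<open>f\<close>.
  The map \<open>f\<close> takes values in an inner product space, so that complex functions and pairs of
  complex functions are covered alike. The next two functions are the first and second derivatives
  along a curve, in terms of the derivatives \<open>f'\<close>, \<open>f''\<close> of \<open>f\<close>.
\<close>

definition reg_pow :: "real \<Rightarrow> real \<Rightarrow> 'a::real_inner \<Rightarrow> real" where
  "reg_pow r e f = ((norm f)\<^sup>2 + e) powr r"

definition reg_pow' :: "real \<Rightarrow> real \<Rightarrow> 'a::real_inner \<Rightarrow> 'a \<Rightarrow> real" where
  "reg_pow' r e f f' = 2 * r * ((norm f)\<^sup>2 + e) powr (r - 1) * (f \<bullet> f')"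

definition reg_pow'' :: "real \<Rightarrow> real \<Rightarrow> 'a::real_inner \<Rightarrow> 'a \<Rightarrow> 'a \<Rightarrow> real" where
  "reg_pow'' r e f f' f'' = 4 * r * (r - 1) * ((norm f)\<^sup>2 + e) powr (r - 2) * (f \<bullet> f')\<^sup>2
     + 2 * r * ((norm f)\<^sup>2 + e) powr (r - 1) * ((norm f')\<^sup>2 + f \<bullet> f'')"

lemma has_real_derivative_inner:
  assumes "(f has_vector_derivative f') (at t)" "(g has_vector_derivative g') (at t)"
  shows "((\<lambda>t. f t \<bullet> g t) has_real_derivative f t \<bullet> g' + f' \<bullet> g t) (at t)"
  unfolding has_field_derivative_def
  by (rule has_derivative_eq_rhs[OF has_derivative_inner[OF assms[unfolded has_vector_derivative_def]]])
     (simp add: fun_eq_iff algebra_simps)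

lemma has_real_derivative_reg_pow:
  assumes "0 < e" "(f has_vector_derivative f') (at t)"
  shows "((\<lambda>t. reg_pow r e (f t)) has_real_derivative reg_pow' r e (f t) f') (at t)"
proof -
  have pos: "0 < f t \<bullet> f t + e" for t using assms(1) by (simp add: add_nonneg_pos)
  show ?thesis
    unfolding reg_pow_def reg_pow'_def power2_norm_eq_inner
    using pos[of t]
    by (auto intro!: derivative_eq_intros has_real_derivative_inner[OF assms(2,2)]
       simp: inner_commute)
qed

lemma has_real_derivative_reg_pow':
  assumes "0 < e" "(f has_vector_derivative g t) (at t)" "(g has_vector_derivative g') (at t)"
  shows "((\<lambda>t. reg_pow' r e (f t) (g t)) has_real_derivative reg_pow'' r e (f t) (g t) g') (at t)"
proof -
  have pos: "0 < f t \<bullet> f t + e" for t using assms(1) by (simp add: add_nonneg_pos)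
  show ?thesis
    unfolding reg_pow'_def reg_pow''_def power2_norm_eq_inner
    using pos[of t]
    by (auto intro!: derivative_eq_intros has_real_derivative_inner[OF assms(2,2)]
          has_real_derivative_inner[OF assms(2,3)]
       simp: inner_commute power2_eq_square algebra_simps)
qed

text \<open>
  For \<open>f\<close> harmonic, \<open>f\<^sub>x\<^sub>x = - f\<^sub>t\<^sub>t\<close>, so \<open>L\<close> is the Laplacian of \<open>(|f|\<^sup>2 + e)\<^sup>r\<close>. The terms with \<open>ftt\<close>
  cancel, and what remains besides the main term is nonpositive as \<open>r \<le> 1\<close>. This gives the upper
  bound; the lower bound controls this remainder by Cauchy-Schwarz, at the price of the factor
  \<open>2 r - 1\<close>, which for \<open>r = q / 2\<close> is the \<open>q - 1\<close> in the denominator of Riesz's inequality.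
\<close>

lemma laplacian_reg_pow:
  fixes f ft fx ftt :: "'a::real_inner"
  assumes "1/2 \<le> r" "r \<le> 1" "0 < e"
  defines "L \<equiv> reg_pow'' r e f ft ftt + reg_pow'' r e f fx (- ftt)"
    and "E \<equiv> (norm ft)\<^sup>2 + (norm fx)\<^sup>2"
  shows "L \<le> 2 * r * ((norm f)\<^sup>2 + e) powr (r - 1) * E"
    and "2 * r * (2 * r - 1) * ((norm f)\<^sup>2 + e) powr (r - 1) * E \<le> L"
proof -
  define S where "S = (norm f)\<^sup>2 + e"
  have S: "0 < S" using assms(3) by (simp add: S_def add_nonneg_pos)
  define Q where "Q = (f \<bullet> ft)\<^sup>2 + (f \<bullet> fx)\<^sup>2"
  have L: "L = 2 * r * S powr (r - 1) * E - 4 * r * (1 - r) * (S powr (r - 2) * Q)"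
    unfolding L_def E_def reg_pow''_def S_def[symmetric] Q_def by (simp add: algebra_simps)
  show "L \<le> 2 * r * ((norm f)\<^sup>2 + e) powr (r - 1) * E"
    unfolding L S_def[symmetric] using assms(1,2) by (simp add: Q_def)
  have CS: "(f \<bullet> v)\<^sup>2 \<le> S * (norm v)\<^sup>2" for v
  proof -
    have "(f \<bullet> v)\<^sup>2 \<le> (norm f)\<^sup>2 * (norm v)\<^sup>2"
      using Cauchy_Schwarz_ineq[of f v] by (simp add: power2_norm_eq_inner)
    also have "\<dots> \<le> S * (norm v)\<^sup>2" using assms(3) by (intro mult_right_mono) (auto simp: S_def)
    finally show ?thesis .
  qed
  have "S powr (r - 2) * Q \<le> S powr (r - 2) * (S * E)"
    using CS[of ft] CS[of fx] unfolding Q_def E_def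
    by (intro mult_left_mono) (auto simp: algebra_simps)
  also have "\<dots> = S powr (r - 1) * E"
    using S powr_add[of S "r - 2" 1] by simp
  finally have "4 * r * (1 - r) * (S powr (r - 2) * Q) \<le> 4 * r * (1 - r) * (S powr (r - 1) * E)"
    using assms(1,2) by (intro mult_left_mono) auto
  then show "2 * r * (2 * r - 1) * ((norm f)\<^sup>2 + e) powr (r - 1) * E \<le> L"
    unfolding L S_def[symmetric] by (simp add: algebra_simps)
qed

section \<open>The Riesz projection on trigonometric polynomials\<close>

lemma continuous_on_cis [continuous_intros]:
  "continuous_on A f \<Longrightarrow> continuous_on A (\<lambda>x. cis (f x))"
  unfolding cis_conv_exp by (intro continuous_intros)

text \<open>
  In the coordinate \<open>\<zeta> = t + i x\<close> with \<open>z = e\<^sup>\<zeta>\<close>, differentiating \<open>p(z)\<close> amounts to applying the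
  Euler operator \<open>p(z) \<mapsto> z p'(z)\<close>, so that all derivatives are again polynomials in \<open>z\<close>.
\<close>

lemma has_vector_derivative_poly_exp:
  fixes p :: "complex poly"
  defines "w \<equiv> \<lambda>t x. exp (of_real t + \<i> * of_real x)"
  shows "((\<lambda>t. poly p (w t x)) has_vector_derivative poly (pCons 0 (pderiv p)) (w t x)) (at t)"
    and "((\<lambda>x. poly p (w t x)) has_vector_derivative \<i> * poly (pCons 0 (pderiv p)) (w t x)) (at x)"
proof -
  have fd: "((\<lambda>z. poly p (exp z)) has_field_derivative poly (pCons 0 (pderiv p)) (exp z)) (at z)" for z
    by (auto intro!: derivative_eq_intros simp: algebra_simps)
  have "((\<lambda>t. of_real t + \<i> * of_real x) has_vector_derivative 1) (at t)"
    by (rule has_vector_derivative_real_field) (auto intro!: derivative_eq_intros)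
  from field_vector_diff_chain_at[OF this fd]
  show "((\<lambda>t. poly p (w t x)) has_vector_derivative poly (pCons 0 (pderiv p)) (w t x)) (at t)"
    by (simp add: w_def o_def)
  have "((\<lambda>x. of_real t + \<i> * of_real x) has_vector_derivative \<i>) (at x)"
    by (rule has_vector_derivative_real_field) (auto intro!: derivative_eq_intros)
  from field_vector_diff_chain_at[OF this fd]
  show "((\<lambda>x. poly p (w t x)) has_vector_derivative \<i> * poly (pCons 0 (pderiv p)) (w t x)) (at x)"
    by (simp add: w_def o_def)
qed

lemma continuous_on_reg_pow [continuous_intros]:
  fixes f g h :: "'b::topological_space \<Rightarrow> 'a::real_inner"
  assumes "0 < e" "continuous_on A f"
  shows "continuous_on A (\<lambda>x. reg_pow r e (f x))"
    and "continuous_on A g \<Longrightarrow> continuous_on A (\<lambda>x. reg_pow' r e (f x) (g x))"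
    and "continuous_on A g \<Longrightarrow> continuous_on A h \<Longrightarrow>
      continuous_on A (\<lambda>x. reg_pow'' r e (f x) (g x) (h x))"
proof -
  have "(norm y)\<^sup>2 + e \<noteq> 0" for y :: 'a
    using assms(1) zero_le_power2[of "norm y"] by linarith
  then show "continuous_on A (\<lambda>x. reg_pow r e (f x))"
    and "continuous_on A g \<Longrightarrow> continuous_on A (\<lambda>x. reg_pow' r e (f x) (g x))"
    and "continuous_on A g \<Longrightarrow> continuous_on A h \<Longrightarrow>
      continuous_on A (\<lambda>x. reg_pow'' r e (f x) (g x) (h x))"
    unfolding reg_pow_def reg_pow'_def reg_pow''_def
    using assms(2) by (auto intro!: continuous_intros)
qed

text \<open>
  The function \<open>W\<close> in the proof is \<open>C (|f|\<^sup>2 + e)\<^sup>r - (|g|\<^sup>2 + e)\<^sup>r\<close> with \<open>f = p + cnj h\<close> and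
  \<open>g = (p, h)\<close>. Both harmonic maps have the same energy \<open>E\<close>, since the mixed terms of \<open>|f\<^sub>t|\<^sup>2\<close> and
  \<open>|f\<^sub>x|\<^sup>2\<close> cancel, and \<open>C (2 r - 1) = 2\<close> makes up for the factor \<open>2\<close> in \<open>|f|\<^sup>2 \<le> 2 |g|\<^sup>2\<close>. At the
  origin \<open>W\<close> is nonnegative because \<open>h\<close> vanishes there and \<open>C \<ge> 1\<close>.
\<close>

lemma riesz_projection_regularised:
  fixes p h :: "complex poly"
  assumes h0: "poly h 0 = 0" and q: "1 < q" "q \<le> 2" and e: "0 < e"
  shows "integral {-pi..pi} (\<lambda>x. reg_pow (q/2) e (poly p (cis x), poly h (cis x)))
    \<le> 2 / (q - 1) * integral {-pi..pi} (\<lambda>x. reg_pow (q/2) e (poly p (cis x) + cnj (poly h (cis x))))"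
proof -
  define C where "C = 2 / (q - 1)"
  define r where "r = q / 2"
  have r: "1/2 \<le> r" "r \<le> 1" and C: "C * (2 * r - 1) = 2" "1 \<le> C"
    using q by (auto simp: r_def C_def field_simps)
  define w where "w t x = exp (of_real t + \<i> * of_real x)" for t x :: real
  define D :: "complex poly \<Rightarrow> complex poly" where "D s = pCons 0 (pderiv s)" for s
  have dt: "((\<lambda>t. poly s (w t x)) has_vector_derivative poly (D s) (w t x)) (at t)"
   and dx: "((\<lambda>x. poly s (w t x)) has_vector_derivative \<i> * poly (D s) (w t x)) (at x)" for s t x
    unfolding w_def D_def by (rule has_vector_derivative_poly_exp)+
  have dx': "((\<lambda>x. \<i> * poly s (w t x)) has_vector_derivative - poly (D s) (w t x)) (at x)" for s t x
    using has_vector_derivative_mult_right[OF dx[of s t x], of \<i>] by simp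
  have cw: "continuous_on UNIV (\<lambda>(t, x). w t x)"
    unfolding w_def split_beta by (intro continuous_intros)
  have cw_x: "continuous_on A (w t)" for t A
    unfolding w_def by (intro continuous_intros)
  define f where "f s s' t x = poly s (w t x) + cnj (poly s' (w t x))" for s s' t x
  define g where "g s s' t x = (poly s (w t x), poly s' (w t x))" for s s' t x
  define fx where "fx s s' t x = \<i> * poly s (w t x) + cnj (\<i> * poly s' (w t x))" for s s' t x
  define gx where "gx s s' t x = (\<i> * poly s (w t x), \<i> * poly s' (w t x))" for s s' t x
  have ft: "((\<lambda>t. f s s' t x) has_vector_derivative f (D s) (D s') t x) (at t)" for s s' t x
    unfolding f_def by (intro derivative_intros dt has_vector_derivative_cnj)
  have gt: "((\<lambda>t. g s s' t x) has_vector_derivative g (D s) (D s') t x) (at t)" for s s' t x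
    unfolding g_def by (intro has_vector_derivative_Pair dt)
  have fx: "((\<lambda>x. f s s' t x) has_vector_derivative fx (D s) (D s') t x) (at x)" for s s' t x
    unfolding f_def fx_def by (intro derivative_intros dx has_vector_derivative_cnj)
  have gx: "((\<lambda>x. g s s' t x) has_vector_derivative gx (D s) (D s') t x) (at x)" for s s' t x
    unfolding g_def gx_def by (intro has_vector_derivative_Pair dx)
  have fxx: "((\<lambda>x. fx s s' t x) has_vector_derivative - f (D s) (D s') t x) (at x)" for s s' t x
    unfolding f_def fx_def
    by (rule has_vector_derivative_eq_rhs,
        rule has_vector_derivative_add[OF dx' has_vector_derivative_cnj[OF dx']]) simp
  have gxx: "((\<lambda>x. gx s s' t x) has_vector_derivative - g (D s) (D s') t x) (at x)" for s s' t x
    unfolding g_def gx_def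
    by (rule has_vector_derivative_eq_rhs, rule has_vector_derivative_Pair[OF dx' dx']) simp
  have cf: "continuous_on UNIV (\<lambda>(t, x). f s s' t x)"
    and cg: "continuous_on UNIV (\<lambda>(t, x). g s s' t x)" for s s'
    using cw unfolding f_def g_def split_beta by (auto intro!: continuous_intros)
  have cf_x: "continuous_on A (f s s' t)" and cg_x: "continuous_on A (g s s' t)" for s s' t A
    using cw_x unfolding f_def g_def by (auto intro!: continuous_intros)
  define W where "W t x = C * reg_pow r e (f p h t x) - reg_pow r e (g p h t x)" for t x
  define p1 where "p1 = D p"
  define h1 where "h1 = D h"
  define p2 where "p2 = D p1"
  define h2 where "h2 = D h1"
  note [simp] = p1_def[symmetric] h1_def[symmetric] p2_def[symmetric] h2_def[symmetric]
  have "2 * pi * (C * reg_pow r e (poly p 0) - reg_pow r e (poly p 0)) \<le> integral {-pi..pi} (W 0)"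
  proof (rule circle_mean_ge_limit)
    show "((\<lambda>t. W t x) has_real_derivative
        C * reg_pow' r e (f p h t x) (f p1 h1 t x) - reg_pow' r e (g p h t x) (g p1 h1 t x)) (at t)" for t x
      unfolding W_def using ft[of p h x t] gt[of p h x t]
      by (auto intro!: derivative_eq_intros has_real_derivative_reg_pow e)
    show "((\<lambda>t. C * reg_pow' r e (f p h t x) (f p1 h1 t x) - reg_pow' r e (g p h t x) (g p1 h1 t x))
       has_real_derivative C * reg_pow'' r e (f p h t x) (f p1 h1 t x) (f p2 h2 t x)
         - reg_pow'' r e (g p h t x) (g p1 h1 t x) (g p2 h2 t x)) (at t)" for t x
      using ft[of p h x t] gt[of p h x t] ft[of p1 h1 x t] gt[of p1 h1 x t]
      by (auto intro!: derivative_eq_intros has_real_derivative_reg_pow' e)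
    show "((\<lambda>x. C * reg_pow' r e (f p h t x) (fx p1 h1 t x) - reg_pow' r e (g p h t x) (gx p1 h1 t x))
       has_real_derivative C * reg_pow'' r e (f p h t x) (fx p1 h1 t x) (- f p2 h2 t x)
         - reg_pow'' r e (g p h t x) (gx p1 h1 t x) (- g p2 h2 t x)) (at x)" for t x
      using fx[of p h t x] gx[of p h t x] fxx[of p1 h1 t x] gxx[of p1 h1 t x]
      by (auto intro!: derivative_eq_intros has_real_derivative_reg_pow' e)
    have "w t pi = w t (-pi)" for t by (simp add: w_def exp_add exp_diff)
    then show "C * reg_pow' r e (f p h t pi) (fx p1 h1 t pi) - reg_pow' r e (g p h t pi) (gx p1 h1 t pi)
       = C * reg_pow' r e (f p h t (-pi)) (fx p1 h1 t (-pi)) - reg_pow' r e (g p h t (-pi)) (gx p1 h1 t (-pi))" for t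
      unfolding f_def g_def fx_def gx_def by metis
    show "continuous_on UNIV (W t)" for t
      unfolding W_def[abs_def] by (intro continuous_intros e cf_x cg_x)
    show "continuous_on UNIV (\<lambda>(t, x). C * reg_pow' r e (f p h t x) (f p1 h1 t x) - reg_pow' r e (g p h t x) (g p1 h1 t x))"
      unfolding split_beta
      by (intro continuous_intros e cf[unfolded split_beta] cg[unfolded split_beta])
    show "continuous_on UNIV (\<lambda>(t, x). C * reg_pow'' r e (f p h t x) (f p1 h1 t x) (f p2 h2 t x)
         - reg_pow'' r e (g p h t x) (g p1 h1 t x) (g p2 h2 t x))"
      unfolding split_beta
      by (intro continuous_intros e cf[unfolded split_beta] cg[unfolded split_beta])
    show "0 \<le> C * reg_pow'' r e (f p h t x) (f p1 h1 t x) (f p2 h2 t x)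
         - reg_pow'' r e (g p h t x) (g p1 h1 t x) (g p2 h2 t x) +
        (C * reg_pow'' r e (f p h t x) (fx p1 h1 t x) (- f p2 h2 t x)
         - reg_pow'' r e (g p h t x) (gx p1 h1 t x) (- g p2 h2 t x))" for t x
    proof -
      define S1 where "S1 = (norm (f p h t x))\<^sup>2 + e"
      define S2 where "S2 = (norm (g p h t x))\<^sup>2 + e"
      define E where "E = (norm (g p1 h1 t x))\<^sup>2 + (norm (gx p1 h1 t x))\<^sup>2"
      have E: "(norm (f p1 h1 t x))\<^sup>2 + (norm (fx p1 h1 t x))\<^sup>2 = E"
        unfolding E_def f_def fx_def g_def gx_def norm_Pair
        by (simp add: norm_mult cmod_power2) (simp add: power2_eq_square algebra_simps)
      have pos: "0 < S1" "0 < S2" using e by (auto simp: S1_def S2_def add_nonneg_pos)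
      have "(norm (f p h t x))\<^sup>2 \<le> (cmod (poly p (w t x)) + cmod (poly h (w t x)))\<^sup>2"
        unfolding f_def by (intro power_mono order_trans[OF norm_triangle_ineq]) auto
      also have "\<dots> \<le> 2 * (norm (g p h t x))\<^sup>2"
        unfolding g_def norm_Pair
        using sum_squares_bound[of "cmod (poly p (w t x))" "cmod (poly h (w t x))"] by (simp add: power2_sum)
      finally have S12: "S1 \<le> 2 * S2" using e by (simp add: S1_def S2_def)
      \<comment> \<open>The exponent \<open>r - 1\<close> lies in \<open>[-1, 0]\<close>: the power is decreasing and loses at most a factor \<open>2\<close>.\<close>
      have "S2 powr (r - 1) = 2 * (2 powr - 1 * S2 powr (r - 1))" by (simp add: powr_minus)
      also have "\<dots> \<le> 2 * (2 powr (r - 1) * S2 powr (r - 1))"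
        using r by (intro mult_left_mono mult_right_mono powr_mono) auto
      also have "\<dots> = 2 * (2 * S2) powr (r - 1)"
        using pos by (simp add: powr_mult)
      also have "\<dots> \<le> 2 * S1 powr (r - 1)"
        using S12 pos r by (intro mult_left_mono powr_mono2') auto
      finally have S: "S2 powr (r - 1) \<le> 2 * S1 powr (r - 1)" .
      have "2 * r * S2 powr (r - 1) * E \<le> 2 * r * (2 * S1 powr (r - 1)) * E"
        using S r by (intro mult_right_mono mult_left_mono) (auto simp: E_def)
      also have "\<dots> = C * (2 * r * (2 * r - 1) * S1 powr (r - 1) * E)"
        by (subst C(1)[symmetric]) (simp add: algebra_simps)
      finally have *: "2 * r * S2 powr (r - 1) * E \<le> C * (2 * r * (2 * r - 1) * S1 powr (r - 1) * E)" .
      have "2 * r * (2 * r - 1) * S1 powr (r - 1) * E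
        \<le> reg_pow'' r e (f p h t x) (f p1 h1 t x) (f p2 h2 t x) +
           reg_pow'' r e (f p h t x) (fx p1 h1 t x) (- f p2 h2 t x)"
        using laplacian_reg_pow(2)[OF r e, of "f p h t x" "f p1 h1 t x" "fx p1 h1 t x" "f p2 h2 t x"]
        unfolding E S1_def .
      then have "C * (2 * r * (2 * r - 1) * S1 powr (r - 1) * E)
        \<le> C * (reg_pow'' r e (f p h t x) (f p1 h1 t x) (f p2 h2 t x) +
           reg_pow'' r e (f p h t x) (fx p1 h1 t x) (- f p2 h2 t x))"
        using C(2) by (intro mult_left_mono) auto
      moreover have "reg_pow'' r e (g p h t x) (g p1 h1 t x) (g p2 h2 t x) +
           reg_pow'' r e (g p h t x) (gx p1 h1 t x) (- g p2 h2 t x) \<le> 2 * r * S2 powr (r - 1) * E"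
        using laplacian_reg_pow(1)[OF r e, of "g p h t x" "g p1 h1 t x" "g p2 h2 t x" "gx p1 h1 t x"]
        unfolding E_def S2_def .
      ultimately show ?thesis using * by (simp add: algebra_simps)
    qed
    \<comment> \<open>As a function of the radius \<open>\<rho> = e\<^sup>t\<close> the mean extends continuously to \<open>\<rho> = 0\<close>, which
        identifies its limit at \<open>t \<rightarrow> -\<infinity>\<close> with the value at the origin.\<close>
    define w0 where "w0 z = C * reg_pow r e (poly p z + cnj (poly h z)) - reg_pow r e (poly p z, poly h z)" for z
    define N where "N \<rho> = integral (cbox (-pi) pi) (\<lambda>x. w0 (of_real \<rho> * cis x))" for \<rho>
    have "continuous_on UNIV N"
      unfolding N_def w0_def
      by (rule integral_continuous_on_param) (auto simp: split_beta cis_conv_exp intro!: continuous_intros e)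
    then have "(N \<longlongrightarrow> N 0) (at 0)" by (auto simp: continuous_on_eq_continuous_at isCont_def)
    moreover have "filterlim (\<lambda>t. exp t :: real) (at 0) at_bot"
      using exp_at_bot by (auto simp: filterlim_at)
    ultimately have "((\<lambda>t. N (exp t)) \<longlongrightarrow> N 0) at_bot" by (rule filterlim_compose)
    moreover have "N (exp t) = integral {-pi..pi} (W t)" for t
      unfolding N_def w0_def W_def[abs_def] f_def g_def w_def
      by (simp add: exp_add cis_conv_exp flip: exp_of_real)
    moreover have "N 0 = 2 * pi * (C * reg_pow r e (poly p 0) - reg_pow r e (poly p 0))"
      unfolding N_def w0_def using h0 by (simp add: reg_pow_def norm_Pair)
    ultimately show "((\<lambda>t. integral {-pi..pi} (W t)) \<longlongrightarrow>
        2 * pi * (C * reg_pow r e (poly p 0) - reg_pow r e (poly p 0))) at_bot" by simp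
  qed
  moreover have "0 \<le> 2 * pi * (C * reg_pow r e (poly p 0) - reg_pow r e (poly p 0))"
    using mult_right_mono[OF C(2), of "reg_pow r e (poly p 0)"] by (simp add: reg_pow_def)
  ultimately have "0 \<le> integral {-pi..pi} (W 0)" by simp
  also have "integral {-pi..pi} (W 0) = C * integral {-pi..pi} (\<lambda>x. reg_pow r e (f p h 0 x))
      - integral {-pi..pi} (\<lambda>x. reg_pow r e (g p h 0 x))"
    unfolding W_def[abs_def]
    by (subst integral_diff)
       (auto intro!: integrable_continuous_real continuous_intros e cf_x cg_x)
  finally show ?thesis
    by (simp add: f_def g_def w_def C_def r_def cis_conv_exp)
qed

text \<open>
  The norm of the pair \<open>(p, h)\<close> dominates \<open>|p|\<close>, and the right-hand side of the regularised inequality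
  is continuous in \<open>e\<close> down to \<open>e = 0\<close>.
\<close>

lemma riesz_projection:
  fixes p h :: "complex poly"
  assumes h0: "poly h 0 = 0" and q: "1 < q" "q \<le> 2"
  shows "integral {-pi..pi} (\<lambda>x. cmod (poly p (cis x)) powr q)
    \<le> 2 / (q - 1) * integral {-pi..pi} (\<lambda>x. cmod (poly p (cis x) + cnj (poly h (cis x))) powr q)"
proof -
  define f where "f x = poly p (cis x) + cnj (poly h (cis x))" for x
  have cf: "continuous_on A f" for A unfolding f_def by (auto intro!: continuous_intros)
  have sq: "((norm z)\<^sup>2) powr (q/2) = norm z powr q" for z :: complex
    by (simp add: powr_powr flip: powr_numeral)
  define N where "N e = integral (cbox (-pi) pi) (\<lambda>x. ((norm (f x))\<^sup>2 + e) powr (q/2))" for e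
  have "continuous_on {0..} N"
    unfolding N_def split_beta
    by (rule integral_continuous_on_param)
       (use q in \<open>auto simp: split_beta intro!: continuous_intros continuous_on_powr' continuous_on_compose2[OF cf]\<close>)
  then have "(N \<longlongrightarrow> N 0) (at_right 0)"
    by (auto simp: continuous_on_def intro: tendsto_within_subset)
  then have lim: "((\<lambda>e. 2 / (q - 1) * N e) \<longlongrightarrow> 2 / (q - 1) * N 0) (at_right 0)"
    by (rule tendsto_mult_left)
  have "integral {-pi..pi} (\<lambda>x. cmod (poly p (cis x)) powr q) \<le> 2 / (q - 1) * N e" if e: "0 < e" for e
  proof -
    have "integral {-pi..pi} (\<lambda>x. cmod (poly p (cis x)) powr q)
      \<le> integral {-pi..pi} (\<lambda>x. reg_pow (q/2) e (poly p (cis x), poly h (cis x)))"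
    proof (rule integral_le)
      show "(\<lambda>x. cmod (poly p (cis x)) powr q) integrable_on {-pi..pi}"
        using q by (intro integrable_continuous_real continuous_on_powr' continuous_intros) auto
      show "(\<lambda>x. reg_pow (q/2) e (poly p (cis x), poly h (cis x))) integrable_on {-pi..pi}"
        using e by (intro integrable_continuous_real continuous_intros) auto
      show "cmod (poly p (cis x)) powr q \<le> reg_pow (q/2) e (poly p (cis x), poly h (cis x))" for x
        unfolding sq[symmetric] reg_pow_def norm_Pair
        using q e by (intro powr_mono2) auto
    qed
    also have "\<dots> \<le> 2 / (q - 1) * N e"
      using riesz_projection_regularised[OF h0 q e, of p] by (simp add: N_def reg_pow_def f_def)
    finally show ?thesis .
  qed
  then have "eventually (\<lambda>e. integral {-pi..pi} (\<lambda>x. cmod (poly p (cis x)) powr q) \<le> 2 / (q - 1) * N e) (at_right 0)"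
    by (auto simp: eventually_at_right_less intro: eventually_at_rightI[of 0 1])
  from tendsto_lowerbound[OF lim this] show ?thesis
    by (simp add: N_def f_def sq)
qed

text \<open>
  On the unit circle \<open>z\<^bsup>-j\<^esup> p(z)\<close> is the sum of the shifted polynomial and of powers
  \<open>z\<^bsup>n-j\<^esup> = cnj (z\<^bsup>j-n\<^esup>)\<close> with \<open>n < j\<close>, to which the Riesz projection applies.
\<close>

lemma poly_tail_bound:
  fixes p :: "complex poly"
  assumes q: "1 < q" "q \<le> 2"
  shows "integral {-pi..pi} (\<lambda>x. cmod (poly (monom 1 j * poly_shift j p) (cis x)) powr q)
    \<le> 2 / (q - 1) * integral {-pi..pi} (\<lambda>x. cmod (poly p (cis x)) powr q)"
proof -
  define h where "h = (\<Sum>n<j. monom (cnj (coeff p n)) (j - n))"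
  have h0: "poly h 0 = 0" by (simp add: h_def poly_sum poly_monom power_0_left)
  have split: "p = (\<Sum>n<j. monom (coeff p n) n) + monom 1 j * poly_shift j p"
    by (rule poly_eqI) (auto simp: coeff_sum coeff_monom_mult coeff_poly_shift)
  have eq: "cmod (poly p (cis x)) = cmod (poly (poly_shift j p) (cis x) + cnj (poly h (cis x)))" for x
  proof -
    have "cis x ^ j * cnj (cis x ^ (j - n)) = cis x ^ n" if "n < j" for n
    proof -
      have "cis x ^ (j - n) * cnj (cis x ^ (j - n)) = 1"
        by (simp add: cis_cnj cis_mult flip: power_mult_distrib)
      moreover have "cis x ^ j = cis x ^ n * cis x ^ (j - n)"
        using that by (simp flip: power_add)
      ultimately show ?thesis by (simp only: mult.assoc mult_1_right)
    qed
    then have "cis x ^ j * cnj (poly h (cis x)) = (\<Sum>n<j. coeff p n * cis x ^ n)"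
      unfolding h_def poly_sum poly_monom cnj_sum sum_distrib_left
      by (intro sum.cong) (auto simp: algebra_simps)
    then have "poly p (cis x) = cis x ^ j * (poly (poly_shift j p) (cis x) + cnj (poly h (cis x)))"
      by (subst split) (simp add: poly_sum poly_monom algebra_simps)
    then show ?thesis by (simp add: norm_mult norm_power)
  qed
  show ?thesis
    using riesz_projection[OF h0 q, of "poly_shift j p"]
    by (simp add: eq poly_monom norm_mult norm_power)
qed

lemma cmod_diff_powr_le:
  assumes "0 \<le> q" "q \<le> 2"
  shows "cmod (a - b) powr q \<le> 4 * (cmod a powr q + cmod b powr q)"
proof -
  have "cmod (a - b) \<le> 2 * max (cmod a) (cmod b)" using norm_triangle_ineq4[of a b] by simp
  then have "cmod (a - b) powr q \<le> (2 * max (cmod a) (cmod b)) powr q"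
    using assms by (intro powr_mono2) auto
  also have "\<dots> = 2 powr q * max (cmod a) (cmod b) powr q" by (rule powr_mult)
  also have "\<dots> \<le> 4 * (cmod a powr q + cmod b powr q)"
    using assms powr_mono[of q 2 "2::real"] by (intro mult_mono) (auto simp: max_def)
  finally show ?thesis .
qed

text \<open>
  A block of consecutive coefficients is the difference of two tails. Projecting twice instead
  would give the square of \<open>2 / (q - 1)\<close>, which is too large near \<open>q = 1\<close>.
\<close>

lemma poly_section_bound:
  fixes p :: "complex poly"
  assumes q: "1 < q" "q \<le> 2" and "j \<le> l"
  shows "integral {-pi..pi} (\<lambda>x. cmod (\<Sum>n=j..<l. coeff p n * cis x ^ n) powr q)
    \<le> 16 / (q - 1) * integral {-pi..pi} (\<lambda>x. cmod (poly p (cis x)) powr q)"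
proof -
  define T where "T j x = poly (monom 1 j * poly_shift j p) (cis x)" for j x
  define I where "I f = integral {-pi..pi} (\<lambda>x. cmod (f x) powr q)" for f
  have "(\<Sum>n=j..<l. monom (coeff p n) n) = monom 1 j * poly_shift j p - monom 1 l * poly_shift l p"
    using \<open>j \<le> l\<close> by (intro poly_eqI) (auto simp: coeff_sum coeff_monom_mult coeff_poly_shift)
  then have eq: "(\<Sum>n=j..<l. coeff p n * cis x ^ n) = T j x - T l x" for x
    unfolding T_def by (metis (no_types, lifting) poly_diff poly_sum poly_monom sum.cong)
  have int: "(\<lambda>x. cmod (T j x) powr q) integrable_on {-pi..pi}" for j
    unfolding T_def using q by (intro integrable_continuous_real continuous_on_powr' continuous_intros) auto
  have int': "(\<lambda>x. cmod (T j x - T l x) powr q) integrable_on {-pi..pi}"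
    unfolding T_def using q by (intro integrable_continuous_real continuous_on_powr' continuous_intros) auto
  have "integral {-pi..pi} (\<lambda>x. cmod (T j x - T l x) powr q)
      \<le> integral {-pi..pi} (\<lambda>x. 4 * (cmod (T j x) powr q + cmod (T l x) powr q))"
    by (rule integral_le[OF int' integrable_on_mult_right[OF integrable_add[OF int int]]])
       (use cmod_diff_powr_le q in \<open>auto simp del: distrib_left_numeral\<close>)
  also have "\<dots> = 4 * (I (T j) + I (T l))"
    unfolding I_def using int by (simp add: integral_add)
  also have "\<dots> \<le> 4 * (2 / (q - 1) * I (\<lambda>x. poly p (cis x)) + 2 / (q - 1) * I (\<lambda>x. poly p (cis x)))"
    unfolding I_def T_def using poly_tail_bound[OF q, of _ p] by (intro mult_left_mono add_mono) auto
  finally show ?thesis unfolding eq I_def by simp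
qed

section \<open>Fourier coefficients and partial sums\<close>

lemma finite_measure_X_space: "finite_measure X_space"
  unfolding X_space_def by (rule finite_measure_lebesgue_on) auto

lemma space_X_space [simp]: "space X_space = {-pi..pi}"
  by (simp add: X_space_def)

lemma continuous_imp_integrable_X_space:
  fixes f :: "real \<Rightarrow> 'a::euclidean_space"
  assumes "continuous_on UNIV f"
  shows "integrable X_space f"
  unfolding X_space_def
  using continuous_imp_integrable_real[of "-pi" pi f] continuous_on_subset[OF assms] by auto

lemma continuous_imp_measurable_X_space:
  assumes "continuous_on UNIV (f :: real \<Rightarrow> 'a::euclidean_space)"
  shows "f \<in> borel_measurable X_space"
  using borel_measurable_integrable[OF continuous_imp_integrable_X_space[OF assms]] .

lemma LINT_X_space_eq_integral:
  fixes f :: "real \<Rightarrow> 'a::euclidean_space"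
  assumes "continuous_on UNIV f"
  shows "(LINT x|X_space. f x) = integral {-pi..pi} f"
  using continuous_imp_integrable_X_space[OF assms] unfolding X_space_def
  by (intro lebesgue_integral_eq_integral) auto

lemma fourier_coeff_cis:
  "fourier_coeff f m = (LINT x|X_space. cis (of_int m * x) * f x)"
  unfolding fourier_coeff_def by (simp add: cis_conv_exp mult_ac)

lemma fourier_partial_sum_cis:
  "fourier_partial_sum M f x =
    (\<Sum>m\<in>{- int M..int M}. fourier_coeff f m / (2 * of_real pi) * cis (- of_int m * x))"
  unfolding fourier_partial_sum_def by (simp add: cis_conv_exp mult_ac sum_divide_distrib)

lemma continuous_on_fourier_partial_sum [continuous_intros]:
  "continuous_on A (fourier_partial_sum M f)"
  unfolding fourier_partial_sum_def[abs_def] by (intro continuous_intros) auto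

lemma integrable_cis_mult:
  assumes "integrable X_space f"
  shows "integrable X_space (\<lambda>x. cis (c * x) * f x)"
proof (rule Bochner_Integration.integrable_bound[OF assms])
  show "(\<lambda>x. cis (c * x) * f x) \<in> borel_measurable X_space"
    by (intro borel_measurable_times continuous_imp_measurable_X_space continuous_intros
          borel_measurable_integrable[OF assms])
qed (auto simp: norm_mult)

text \<open>
  By linearity both integrals equal \<open>\<Sum> c(m) d(-m) / (2 \<pi>)\<close> over \<open>|m| \<le> M\<close>, where \<open>c\<close> and \<open>d\<close> are the
  Fourier coefficients of \<open>f\<close> and \<open>g\<close>, and this range is symmetric.
\<close>

lemma LINT_fourier_partial_sum_mult_commute:
  assumes f: "integrable X_space f" and g: "integrable X_space g"
  shows "(LINT x|X_space. fourier_partial_sum M f x * g x) = (LINT x|X_space. f x * fourier_partial_sum M g x)"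
proof -
  have *: "(LINT x|X_space. fourier_partial_sum M f x * g x) =
      (\<Sum>m\<in>{- int M..int M}. fourier_coeff f m * fourier_coeff g (- m) / (2 * of_real pi))"
    if g: "integrable X_space g" for f g
  proof -
    have "(LINT x|X_space. fourier_partial_sum M f x * g x) =
      (LINT x|X_space. (\<Sum>m\<in>{- int M..int M}. fourier_coeff f m / (2 * of_real pi) * (cis (of_int (- m) * x) * g x)))"
      unfolding fourier_partial_sum_cis sum_distrib_right by (simp add: mult.assoc)
    also have "\<dots> = (\<Sum>m\<in>{- int M..int M}. fourier_coeff f m / (2 * of_real pi) * fourier_coeff g (- m))"
      unfolding fourier_coeff_cis
      by (subst Bochner_Integration.integral_sum) (intro integrable_mult_right integrable_cis_mult g, simp)
    finally show ?thesis by simp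
  qed
  have "(\<Sum>m\<in>{- int M..int M}. fourier_coeff f m * fourier_coeff g (- m) / (2 * of_real pi)) =
        (\<Sum>m\<in>{- int M..int M}. fourier_coeff g m * fourier_coeff f (- m) / (2 * of_real pi))"
    by (rule sum.reindex_bij_witness[where i=uminus and j=uminus]) auto
  then show ?thesis
    using *[OF g, of f] *[OF f, of g] by (simp add: mult.commute)
qed

lemma LINT_cis_int:
  "(LINT x|X_space. cis (of_int k * x)) = (if k = 0 then 2 * of_real pi else 0)"
proof (cases "k = 0")
  case True
  then show ?thesis
    using LINT_X_space_eq_integral[of "\<lambda>_. 1 :: complex"] by (simp add: scaleR_conv_of_real)
next
  case False
  have "((\<lambda>x. cis (of_int k * x)) has_integral
      cis (of_int k * pi) / (\<i> * of_int k) - cis (of_int k * (-pi)) / (\<i> * of_int k)) {-pi..pi}"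
  proof (rule fundamental_theorem_of_calculus)
    fix x :: real
    have "((\<lambda>z. exp (\<i> * of_int k * z) / (\<i> * of_int k)) has_field_derivative exp (\<i> * of_int k * of_real x)) (at (of_real x))"
      using False by (auto intro!: derivative_eq_intros)
    from has_vector_derivative_real_field[OF this]
    show "((\<lambda>x. cis (of_int k * x) / (\<i> * of_int k)) has_vector_derivative cis (of_int k * x)) (at x within {-pi..pi})"
      by (simp add: cis_conv_exp mult_ac has_vector_derivative_at_within)
  qed simp
  moreover have "cis (of_int k * pi) = cis (of_int k * (-pi))"
    by (simp add: complex_eq_iff sin_integer_2pi sin_zero_iff_int2)
  ultimately have "integral {-pi..pi} (\<lambda>x. cis (of_int k * x)) = 0"
    by (simp add: integral_unique)
  then show ?thesis
    using False by (simp add: LINT_X_space_eq_integral continuous_intros)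
qed

lemma cis_power_mult: "cis x ^ n * cis y = cis (real n * x + y)"
  unfolding Complex.DeMoivre cis_mult ..

text \<open>
  The kernel \<open>e\<^bsup>imx\<^esup>\<close> of the coefficients picks out the frequency \<open>-m\<close>, which is carried by the
  coefficient of \<open>p\<close> with index \<open>N - m\<close>.
\<close>

lemma fourier_coeff_laurent:
  "fourier_coeff (\<lambda>x. cis (- real N * x) * poly p (cis x)) m =
    2 * of_real pi * (if m \<le> int N then coeff p (nat (int N - m)) else 0)"
proof -
  have "fourier_coeff (\<lambda>x. cis (- real N * x) * poly p (cis x)) m =
     (LINT x|X_space. (\<Sum>n\<le>degree p. coeff p n * cis (of_int (m - int N + int n) * x)))"
    unfolding fourier_coeff_cis poly_altdef sum_distrib_left
    by (intro Bochner_Integration.integral_cong refl sum.cong)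
       (simp add: cis_power_mult cis_mult algebra_simps)
  also have "\<dots> = (\<Sum>n\<le>degree p. coeff p n * (LINT x|X_space. cis (of_int (m - int N + int n) * x)))"
    by (subst Bochner_Integration.integral_sum)
       (intro integrable_mult_right continuous_imp_integrable_X_space continuous_intros, simp)
  also have "\<dots> = (\<Sum>n\<le>degree p. if int n = int N - m then coeff p n * (2 * of_real pi) else 0)"
    unfolding LINT_cis_int by (intro sum.cong) auto
  also have "\<dots> = 2 * of_real pi * (if m \<le> int N then coeff p (nat (int N - m)) else 0)"
  proof (cases "m \<le> int N")
    case True
    then have "(int n = int N - m) = (n = nat (int N - m))" for n by auto
    then show ?thesis using True by (auto simp: coeff_eq_0)
  next
    case False
    then show ?thesis by (auto intro!: sum.neutral)
  qed
  finally show ?thesis .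
qed

lemma fourier_partial_sum_laurent:
  assumes "M \<le> N"
  shows "fourier_partial_sum M (\<lambda>x. cis (- real N * x) * poly p (cis x)) x =
     cis (- real N * x) * (\<Sum>n=N-M..<N+M+1. coeff p n * cis x ^ n)"
proof -
  have "fourier_partial_sum M (\<lambda>x. cis (- real N * x) * poly p (cis x)) x =
      (\<Sum>m\<in>{- int M..int M}. coeff p (nat (int N - m)) * cis (- of_int m * x))"
    unfolding fourier_partial_sum_cis fourier_coeff_laurent
    using assms by (intro sum.cong) auto
  also have "\<dots> = (\<Sum>n=N-M..<N+M+1. coeff p n * cis (- of_int (int N - int n) * x))"
    by (rule sum.reindex_bij_witness[where i="\<lambda>n. int N - int n" and j="\<lambda>m. nat (int N - m)"])
       (use assms in auto)
  also have "\<dots> = cis (- real N * x) * (\<Sum>n=N-M..<N+M+1. coeff p n * cis x ^ n)"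
    unfolding sum_distrib_left
    by (intro sum.cong refl) (simp add: cis_power_mult algebra_simps)
  finally show ?thesis .
qed

lemma fourier_partial_sum_bound_laurent:
  fixes p :: "complex poly"
  assumes "1 < q" "q \<le> 2" "M \<le> N"
  defines "g \<equiv> \<lambda>x. cis (- real N * x) * poly p (cis x)"
  shows "(LINT x|X_space. cmod (fourier_partial_sum M g x) powr q)
    \<le> 16 / (q - 1) * (LINT x|X_space. cmod (g x) powr q)"
proof -
  have cont: "continuous_on UNIV (\<lambda>x. cmod (poly p (cis x)) powr q)"
    "continuous_on UNIV (\<lambda>x. cmod (\<Sum>n=N-M..<N+M+1. coeff p n * cis x ^ n) powr q)"
    using assms(1) by (intro continuous_on_powr' continuous_intros; simp)+
  have "N - M \<le> N + M + 1" by simp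
  from poly_section_bound[OF assms(1,2) this, of p] show ?thesis
    unfolding g_def fourier_partial_sum_laurent[OF assms(3)] norm_mult norm_cis mult_1_left
      cont[THEN LINT_X_space_eq_integral] .
qed

section \<open>Partial sums of continuous functions\<close>

text \<open>
  On the unit circle \<open>Re z\<close> and \<open>Im z\<close> are Laurent polynomials in \<open>z\<close>, hence so is every real
  polynomial in these coordinates; this gives access to the Stone-Weierstrass theorem.
\<close>

definition laurent_fun :: "(complex \<Rightarrow> complex) \<Rightarrow> bool" where
  "laurent_fun g \<longleftrightarrow> (\<exists>N p. \<forall>z. cmod z = 1 \<longrightarrow> g z = poly p z / z ^ N)"

lemma laurent_fun_add: assumes "laurent_fun f" "laurent_fun g" shows "laurent_fun (\<lambda>z. f z + g z)"
proof -
  obtain N p K s where *: "\<And>z. cmod z = 1 \<Longrightarrow> f z = poly p z / z ^ N" "\<And>z. cmod z = 1 \<Longrightarrow> g z = poly s z / z ^ K"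
    using assms unfolding laurent_fun_def by metis
  show ?thesis
    unfolding laurent_fun_def
  proof (intro exI allI impI)
    fix z :: complex assume z: "cmod z = 1"
    then have "z \<noteq> 0" by auto
    with * z show "f z + g z = poly (p * monom 1 K + s * monom 1 N) z / z ^ (N + K)"
      by (simp add: poly_monom field_simps power_add)
  qed
qed

lemma laurent_fun_mult: assumes "laurent_fun f" "laurent_fun g" shows "laurent_fun (\<lambda>z. f z * g z)"
proof -
  obtain N p K s where *: "\<And>z. cmod z = 1 \<Longrightarrow> f z = poly p z / z ^ N" "\<And>z. cmod z = 1 \<Longrightarrow> g z = poly s z / z ^ K"
    using assms unfolding laurent_fun_def by metis
  show ?thesis
    unfolding laurent_fun_def
    by (rule exI[of _ "N + K"], rule exI[of _ "p * s"]) (use * in \<open>auto simp: power_add\<close>)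
qed

lemma laurent_fun_const: "laurent_fun (\<lambda>_. c)"
  unfolding laurent_fun_def by (rule exI[of _ 0], rule exI[of _ "[:c:]"]) auto

lemma laurent_fun_real_polynomial:
  assumes "real_polynomial_function g"
  shows "laurent_fun (\<lambda>z. of_real (g z))"
  using assms
proof induction
  case (linear f)
  interpret bounded_linear f by fact
  define a b where "a = complex_of_real (f 1)" and "b = complex_of_real (f \<i>)"
  have "of_real (f z) = of_real (Re z) * a + of_real (Im z) * b" for z
  proof -
    have "z = Re z *\<^sub>R 1 + Im z *\<^sub>R \<i>" by (simp add: complex_eq_iff)
    then have "f z = Re z * f 1 + Im z * f \<i>" by (metis add scaleR real_scaleR_def)
    then show ?thesis by (simp add: a_def b_def)
  qed
  moreover have "of_real (Re z) = poly [:1/2, 0, 1/2:] z / z ^ 1"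
                "of_real (Im z) = poly [:- 1/(2*\<i>), 0, 1/(2*\<i>):] z / z ^ 1" if "cmod z = 1" for z
  proof -
    have nz: "z \<noteq> 0" using that by auto
    have "z * cnj z = 1" using that by (simp add: complex_norm_square[symmetric])
    then have c: "cnj z = 1 / z" using nz by (simp add: field_simps)
    show "of_real (Re z) = poly [:1/2, 0, 1/2:] z / z ^ 1"
      using complex_add_cnj[of z] nz unfolding c by (simp add: field_simps)
    show "of_real (Im z) = poly [:- 1/(2*\<i>), 0, 1/(2*\<i>):] z / z ^ 1"
      using complex_diff_cnj[of z] nz unfolding c by (simp add: field_simps)
  qed
  then have "laurent_fun (\<lambda>z. of_real (Re z))" "laurent_fun (\<lambda>z. of_real (Im z))"
    unfolding laurent_fun_def by blast+
  ultimately show ?case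
    by (simp add: laurent_fun_add laurent_fun_mult laurent_fun_const)
qed (auto intro: laurent_fun_add laurent_fun_mult laurent_fun_const)

text \<open>
  The pole order \<open>N\<close> can be prescribed to be at least \<open>M\<close>, by multiplying numerator and denominator
  by a power of \<open>z\<close>; then all frequencies in the partial sum of order \<open>M\<close> have natural indices.
\<close>

lemma laurent_approximation:
  assumes k: "continuous_on (sphere 0 1) (k :: complex \<Rightarrow> complex)" and e: "0 < e"
  obtains N p where "M \<le> N" "\<And>x. cmod (k (cis x) - cis (- real N * x) * poly p (cis x)) < e"
proof -
  obtain g where g: "polynomial_function g" "\<And>z. z \<in> sphere 0 1 \<Longrightarrow> cmod (k z - g z) < e"
    using Stone_Weierstrass_polynomial_function[OF compact_sphere k e] by blast
  have "real_polynomial_function (Re \<circ> g)" "real_polynomial_function (Im \<circ> g)"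
    using g(1) unfolding polynomial_function_def by (auto intro: bounded_linear_Re bounded_linear_Im)
  then have "laurent_fun (\<lambda>z. of_real (Re (g z)) + \<i> * of_real (Im (g z)))"
    using laurent_fun_real_polynomial unfolding o_def
    by (intro laurent_fun_add laurent_fun_mult laurent_fun_const) auto
  then obtain N p where p: "\<And>z. cmod z = 1 \<Longrightarrow> g z = poly p z / z ^ N"
    unfolding laurent_fun_def complex_eq[symmetric] by blast
  show thesis
  proof (rule that)
    show "M \<le> N + M" by simp
    fix x
    have "cis (- real (N + M) * x) * cis x ^ (N + M) = 1"
      by (simp add: cis_power_mult mult.commute[of "cis _"] algebra_simps)
    then have "cis (- real (N + M) * x) * (cis x ^ M * poly p (cis x)) = poly p (cis x) / cis x ^ N"
      by (simp add: field_simps power_add)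
    then have "cis (- real (N + M) * x) * poly (monom 1 M * p) (cis x) = g (cis x)"
      using p[of "cis x"] by (simp add: poly_monom)
    then show "cmod (k (cis x) - cis (- real (N + M) * x) * poly (monom 1 M * p) (cis x)) < e"
      using g(2)[of "cis x"] by simp
  qed
qed

lemma measure_X_space: "measure X_space {-pi..pi} = 2 * pi"
  using LINT_X_space_eq_integral[of "\<lambda>_. 1 :: real"] by simp

lemma cmod_fourier_coeff_le:
  assumes "integrable X_space f" "\<And>x. cmod (f x) \<le> B"
  shows "cmod (fourier_coeff f m) \<le> 2 * pi * B"
proof -
  interpret finite_measure X_space by (rule finite_measure_X_space)
  have "cmod (fourier_coeff f m) \<le> (LINT x|X_space. cmod (f x))"
    unfolding fourier_coeff_cis
    using integral_norm_bound[of X_space "\<lambda>x. cis (of_int m * x) * f x"] by (simp add: norm_mult)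
  also have "\<dots> \<le> (LINT x|X_space. B)"
    using assms by (intro integral_mono) auto
  finally show ?thesis by (simp add: measure_X_space)
qed

text \<open>
  Uniform convergence of Laurent polynomials to \<open>k\<close> implies bounded pointwise convergence of their
  partial sums of the fixed order \<open>M\<close>, so the inequality passes to the limit.
\<close>

lemma fourier_partial_sum_bound_continuous:
  assumes k: "continuous_on (sphere 0 1) (k :: complex \<Rightarrow> complex)" and q: "1 < q" "q \<le> 2"
  shows "(LINT x|X_space. cmod (fourier_partial_sum M (\<lambda>x. k (cis x)) x) powr q)
    \<le> 16 / (q - 1) * (LINT x|X_space. cmod (k (cis x)) powr q)"
proof -
  interpret finite_measure X_space by (rule finite_measure_X_space)
  define g where "g x = k (cis x)" for x
  have "bounded (k ` sphere 0 1)"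
    by (intro compact_imp_bounded compact_continuous_image k) auto
  then obtain B where B: "\<And>z. cmod z = 1 \<Longrightarrow> cmod (k z) \<le> B"
    unfolding bounded_iff by force
  have "\<forall>n. \<exists>N p. M \<le> N \<and> (\<forall>x. cmod (k (cis x) - cis (- real N * x) * poly p (cis x)) < inverse (real (Suc n)))"
    by (metis laurent_approximation[OF k] inverse_positive_iff_positive of_nat_0_less_iff zero_less_Suc)
  then obtain N p where MN: "\<And>n. M \<le> N n"
    and near: "\<And>n x. cmod (k (cis x) - cis (- real (N n) * x) * poly (p n) (cis x)) < inverse (real (Suc n))"
    by metis
  define G where "G n x = cis (- real (N n) * x) * poly (p n) (cis x)" for n x
  have cG: "continuous_on UNIV (G n)" for n
    unfolding G_def by (intro continuous_intros)
  have cg: "continuous_on UNIV g"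
    unfolding g_def by (rule continuous_on_compose2[OF k]) (auto intro!: continuous_intros)
  have Glim: "(\<lambda>n. G n x) \<longlonglongrightarrow> g x" for x
  proof (rule Lim_null[THEN iffD2], rule Lim_null_comparison[OF always_eventually LIMSEQ_inverse_real_of_nat], rule allI)
    show "norm (G n x - g x) \<le> inverse (real (Suc n))" for n
      using near[of x n] by (simp add: G_def g_def norm_minus_commute)
  qed
  have GB: "cmod (G n x) \<le> B + 1" for n x
  proof -
    have "cmod (G n x) \<le> cmod (g x) + cmod (G n x - g x)" by (rule norm_triangle_sub)
    moreover have "inverse (real (Suc n)) \<le> 1" by (simp add: field_simps)
    then have "cmod (G n x - g x) \<le> 1"
      using near[of x n] by (simp add: G_def g_def norm_minus_commute)
    ultimately show ?thesis using B[of "cis x"] by (simp add: g_def)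
  qed
  have coeff: "(\<lambda>n. fourier_coeff (G n) m) \<longlonglongrightarrow> fourier_coeff g m" for m
    unfolding fourier_coeff_cis
    by (rule integral_dominated_convergence[where w="\<lambda>_. B + 1"])
       (auto simp: norm_mult intro!: continuous_imp_measurable_X_space continuous_intros cG cg tendsto_intros Glim GB)
  then have Slim: "(\<lambda>n. fourier_partial_sum M (G n) x) \<longlonglongrightarrow> fourier_partial_sum M g x" for x
    unfolding fourier_partial_sum_cis by (intro tendsto_intros) auto
  have SB: "cmod (fourier_partial_sum M (G n) x) \<le> (\<Sum>m\<in>{- int M..int M}. B + 1)" for n x
    unfolding fourier_partial_sum_cis
  proof (rule sum_norm_le)
    fix m
    show "cmod (fourier_coeff (G n) m / (2 * of_real pi) * cis (- of_int m * x)) \<le> B + 1"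
      using cmod_fourier_coeff_le[OF continuous_imp_integrable_X_space[OF cG] GB, of n m]
      by (simp add: norm_mult norm_divide field_simps)
  qed
  have "(\<lambda>n. LINT x|X_space. cmod (G n x) powr q) \<longlonglongrightarrow> (LINT x|X_space. cmod (g x) powr q)"
    by (rule integral_dominated_convergence[where w="\<lambda>_. (B + 1) powr q"])
       (use q GB in \<open>auto intro!: continuous_imp_measurable_X_space continuous_on_powr' continuous_on_norm cG cg
          tendsto_powr' tendsto_norm Glim powr_mono2 continuous_on_const\<close>)
  then have lim: "(\<lambda>n. 16 / (q - 1) * (LINT x|X_space. cmod (G n x) powr q))
      \<longlonglongrightarrow> 16 / (q - 1) * (LINT x|X_space. cmod (g x) powr q)"
    by (rule tendsto_mult_left)
  have lim_S: "(\<lambda>n. LINT x|X_space. cmod (fourier_partial_sum M (G n) x) powr q)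
      \<longlonglongrightarrow> (LINT x|X_space. cmod (fourier_partial_sum M g x) powr q)"
    by (rule integral_dominated_convergence[where w="\<lambda>_. (\<Sum>m\<in>{- int M..int M}. B + 1) powr q"])
       (use q SB in \<open>auto intro!: continuous_imp_measurable_X_space continuous_on_powr' continuous_on_norm
          continuous_on_fourier_partial_sum tendsto_powr' tendsto_norm Slim powr_mono2 continuous_on_const
          simp del: sum_constant\<close>)
  have "(LINT x|X_space. cmod (fourier_partial_sum M g x) powr q)
      \<le> 16 / (q - 1) * (LINT x|X_space. cmod (g x) powr q)"
  proof (rule LIMSEQ_le[OF lim_S lim], intro exI allI impI)
    show "(LINT x|X_space. cmod (fourier_partial_sum M (G n) x) powr q)
        \<le> 16 / (q - 1) * (LINT x|X_space. cmod (G n x) powr q)" for n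
      unfolding G_def by (rule fourier_partial_sum_bound_laurent[OF q MN])
  qed
  then show ?thesis by (simp add: g_def[abs_def])
qed

section \<open>Duality\<close>

lemma Holder_inequality:
  fixes f g :: "'a \<Rightarrow> complex"
  assumes pq: "1 < p" "1 < q" "1 / p + 1 / q = 1"
    and [measurable]: "f \<in> borel_measurable M" "g \<in> borel_measurable M"
    and f: "integrable M (\<lambda>x. cmod (f x) powr p)" and g: "integrable M (\<lambda>x. cmod (g x) powr q)"
  defines "A \<equiv> LINT x|M. cmod (f x) powr p" and "B \<equiv> LINT x|M. cmod (g x) powr q"
  shows "cmod (LINT x|M. f x * g x) \<le> A powr (1 / p) * B powr (1 / q)"
proof -
  have 0: "(LINT x|M. f x * g x) = 0" if "(AE x in M. f x = 0) \<or> (AE x in M. g x = 0)"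
    using that by (intro integral_eq_zero_AE) auto
  have nonneg: "0 \<le> A" "0 \<le> B" unfolding A_def B_def by auto
  show ?thesis
  proof (cases "A = 0 \<or> B = 0")
    case True
    then have "(AE x in M. cmod (f x) powr p = 0) \<or> (AE x in M. cmod (g x) powr q = 0)"
      unfolding A_def B_def
      using integral_nonneg_eq_0_iff_AE[OF f] integral_nonneg_eq_0_iff_AE[OF g] by auto
    then show ?thesis using 0 by simp
  next
    case False
    with nonneg have pos: "0 < A" "0 < B" by auto
    define a b where "a = A powr (1 / p)" and "b = B powr (1 / q)"
    have ab: "0 < a" "0 < b" "a powr p = A" "b powr q = B"
      using pos pq by (auto simp: a_def b_def powr_powr)
    have young: "cmod (f x * g x) \<le> a * b * (cmod (f x) powr p / (A * p) + cmod (g x) powr q / (B * q))" for x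
    proof -
      have "cmod (f x * g x) = a * b * ((cmod (f x) / a) * (cmod (g x) / b))"
        using ab by (simp add: norm_mult)
      also have "\<dots> \<le> a * b * ((cmod (f x) / a) powr p / p + (cmod (g x) / b) powr q / q)"
        using ab by (intro mult_left_mono Youngs_inequality[OF pq]) auto
      finally show ?thesis using ab by (simp add: powr_divide)
    qed
    have int: "integrable M (\<lambda>x. a * b * (cmod (f x) powr p / (A * p) + cmod (g x) powr q / (B * q)))"
      using f g by auto
    have "cmod (LINT x|M. f x * g x) \<le> (LINT x|M. a * b * (cmod (f x) powr p / (A * p) + cmod (g x) powr q / (B * q)))"
    proof (rule order_trans[OF integral_norm_bound integral_mono[OF _ int young]])
      show "integrable M (\<lambda>x. cmod (f x * g x))"
        by (intro integrable_norm Bochner_Integration.integrable_bound[OF int])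
           (auto intro!: AE_I2 order_trans[OF young abs_ge_self])
    qed
    also have "\<dots> = a * b * (A / (A * p) + B / (B * q))"
      using f g by (simp add: A_def B_def)
    also have "\<dots> = a * b" using pos pq(3) by simp
    finally show ?thesis by (simp add: a_def b_def)
  qed
qed

text \<open>
  The map \<open>w \<mapsto> cnj w |w|\<^bsup>p-2\<^esup>\<close> realises equality in Hoelder's inequality. For \<open>p < 2\<close> the second
  factor is unbounded at \<open>0\<close>, but the product has modulus \<open>|w|\<^bsup>p-1\<^esup>\<close>.
\<close>

lemma continuous_on_dual_power:
  assumes "1 < p"
  shows "continuous_on UNIV (\<lambda>w. cnj w * of_real (cmod w powr (p - 2)))"
  unfolding continuous_on_eq_continuous_at[OF open_UNIV]
proof
  fix w :: complex
  show "isCont (\<lambda>w. cnj w * of_real (cmod w powr (p - 2))) w"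
  proof (cases "w = 0")
    case True
    have "((\<lambda>w. cmod w powr (p - 1)) \<longlongrightarrow> 0 powr (p - 1)) (at (0 :: complex))"
      using assms by (intro tendsto_powr' tendsto_norm_zero tendsto_intros) auto
    then have "((\<lambda>w. cmod w powr (p - 1)) \<longlongrightarrow> 0) (at (0 :: complex))"
      by simp
    moreover have "cmod (cnj w * of_real (cmod w powr (p - 2))) = cmod w powr (p - 1)" for w
      using powr_add[of "cmod w" "p - 2" 1] by (simp add: norm_mult)
    ultimately show ?thesis
      using True unfolding isCont_def by (auto intro: tendsto_norm_zero_cancel)
  qed (auto intro!: continuous_intros)
qed

text \<open>
  Partial sums are continuous functions on the circle even if \<open>f\<close> is not; this puts the dual
  function of a partial sum in the scope of bounds for continuous functions.
\<close>

lemma fourier_partial_sum_factors_cis: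
  obtains U where "continuous_on (sphere 0 1) U" "fourier_partial_sum M f = (\<lambda>x. U (cis x))"
proof
  show "continuous_on (sphere 0 1) (\<lambda>z. \<Sum>m\<in>{- int M..int M}. fourier_coeff f m / (2 * of_real pi) * z powi (- m))"
    by (intro continuous_intros) auto
  have "cis (- real_of_int m * x) = cis x powi (- m)" for m x
    using cis_power_int[of x "- m"] by simp
  then show "fourier_partial_sum M f =
      (\<lambda>x. \<Sum>m\<in>{- int M..int M}. fourier_coeff f m / (2 * of_real pi) * cis x powi (- m))"
    unfolding fourier_partial_sum_cis[abs_def] by simp
qed

lemma integrable_if_powr_integrable:
  fixes f :: "'a \<Rightarrow> complex"
  assumes "finite_measure M" "1 \<le> p" "f \<in> borel_measurable M" "integrable M (\<lambda>x. cmod (f x) powr p)"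
  shows "integrable M f"
proof -
  interpret finite_measure M by fact
  have "norm (f x) \<le> norm (1 + cmod (f x) powr p)" for x
  proof (cases "cmod (f x) \<le> 1")
    case False
    then show ?thesis using powr_mono[of 1 p "cmod (f x)"] assms(2) by simp
  qed (simp add: add_increasing2)
  then show ?thesis
    using assms(3,4) by (intro Bochner_Integration.integrable_bound[of M "\<lambda>x. 1 + cmod (f x) powr p" f]) auto
qed

text \<open>
  Test \<open>S f\<close> against \<open>g = cnj (S f) |S f|\<^bsup>p-2\<^esup>\<close>, for which \<open>S f g = |S f|\<^sup>p = |g|\<^sup>q\<close>. Moving \<open>S\<close> to
  \<open>g\<close> and applying Hoelder's inequality and the \<open>L\<^sup>q\<close> bound gives, with \<open>J = \<integral> |S f|\<^sup>p\<close> and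
  \<open>A = \<integral> |f|\<^sup>p\<close>, the inequality \<open>J \<le> A\<^bsup>1/p\<^esup> (K J)\<^bsup>1/q\<^esup>\<close>, which is solved for \<open>J\<close>.
\<close>

lemma fourier_partial_sum_duality:
  assumes pq: "1 < p" "1 < q" "1 / p + 1 / q = 1"
    and bound: "\<And>k. continuous_on (sphere 0 1) k \<Longrightarrow>
      (LINT x|X_space. cmod (fourier_partial_sum M (\<lambda>x. k (cis x)) x) powr q)
        \<le> K * (LINT x|X_space. cmod (k (cis x)) powr q)"
    and f: "f \<in> borel_measurable X_space" "integrable X_space (\<lambda>x. cmod (f x) powr p)"
  shows "(LINT x|X_space. cmod (fourier_partial_sum M f x) powr p)
    \<le> K powr (p - 1) * (LINT x|X_space. cmod (f x) powr p)"
proof -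
  have pq': "(p - 1) * q = p" "p / q = p - 1" using pq by (auto simp: field_simps)
  define S where "S = fourier_partial_sum M"
  define A where "A = (LINT x|X_space. cmod (f x) powr p)"
  define J where "J = (LINT x|X_space. cmod (S f x) powr p)"
  have nonneg: "0 \<le> A" "0 \<le> J" unfolding A_def J_def by auto
  obtain U where U: "continuous_on (sphere 0 1) U" "S f = (\<lambda>x. U (cis x))"
    unfolding S_def by (rule fourier_partial_sum_factors_cis)
  define \<Phi> where "\<Phi> w = cnj w * of_real (cmod w powr (p - 2))" for w
  have cPhi: "continuous_on UNIV \<Phi>"
    unfolding \<Phi>_def using pq(1) by (rule continuous_on_dual_power)
  define g where "g x = \<Phi> (S f x)" for x
  have cS: "continuous_on UNIV (S h)" for h unfolding S_def by (rule continuous_on_fourier_partial_sum)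
  have cg: "continuous_on UNIV g"
    unfolding g_def by (rule continuous_on_compose2[OF cPhi cS]) auto
  have "cmod (\<Phi> w) = cmod w powr (p - 1)" for w
    using powr_add[of "cmod w" "p - 2" 1] by (simp add: \<Phi>_def norm_mult)
  then have g_q: "cmod (g x) powr q = cmod (S f x) powr p" for x
    using pq' by (simp add: g_def powr_powr)
  have Sg: "S f x * g x = of_real (cmod (S f x) powr p)" for x
  proof -
    have "S f x * g x = of_real ((cmod (S f x))\<^sup>2 * cmod (S f x) powr (p - 2))"
      unfolding g_def \<Phi>_def of_real_mult complex_norm_square by (simp add: mult.assoc)
    also have "(cmod (S f x))\<^sup>2 * cmod (S f x) powr (p - 2) = cmod (S f x) powr p"
      using powr_add[of "cmod (S f x)" 2 "p - 2"] by (cases "S f x = 0") auto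
    finally show ?thesis .
  qed
  define B where "B = (LINT x|X_space. cmod (S g x) powr q)"
  have B0: "0 \<le> B" unfolding B_def by auto
  have "B \<le> K * J"
  proof -
    have "g = (\<lambda>x. \<Phi> (U (cis x)))" by (simp add: fun_eq_iff g_def U(2))
    moreover have "continuous_on (sphere 0 1) (\<lambda>z. \<Phi> (U z))"
      by (rule continuous_on_compose2[OF cPhi U(1)]) auto
    moreover have "J = (LINT x|X_space. cmod (g x) powr q)" by (simp add: J_def g_q)
    ultimately show ?thesis
      using bound[of "\<lambda>z. \<Phi> (U z)"] by (simp add: B_def S_def)
  qed
  have "of_real J = (LINT x|X_space. S f x * g x)"
    unfolding Sg J_def by simp
  also have "\<dots> = (LINT x|X_space. f x * S g x)"
    unfolding S_def
    using pq(1)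
    by (intro LINT_fourier_partial_sum_mult_commute continuous_imp_integrable_X_space[OF cg]
          integrable_if_powr_integrable[OF finite_measure_X_space _ f]) simp
  finally have "J = cmod (LINT x|X_space. f x * S g x)"
    using nonneg(2) by (metis norm_of_real abs_of_nonneg)
  also have "\<dots> \<le> A powr (1 / p) * B powr (1 / q)"
    unfolding A_def B_def using pq
    by (intro Holder_inequality[OF pq f(1) _ f(2)] continuous_imp_integrable_X_space
        continuous_imp_measurable_X_space cS continuous_on_powr' continuous_intros) auto
  also have "\<dots> \<le> A powr (1 / p) * (K * J) powr (1 / q)"
    using \<open>B \<le> K * J\<close> pq B0 by (intro mult_left_mono powr_mono2) auto
  finally have J: "J \<le> A powr (1 / p) * (K * J) powr (1 / q)" .
  have "J \<le> K powr (p - 1) * A"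
  proof (cases "J = 0")
    case True
    then show ?thesis using nonneg by simp
  next
    case False
    with nonneg have pos: "0 < J" by simp
    have "J powr (1 / p) * J powr (1 / q) = J"
      using pq(3) pos by (simp flip: powr_add)
    with J have "J powr (1 / p) * J powr (1 / q) \<le> A powr (1 / p) * K powr (1 / q) * J powr (1 / q)"
      by (simp add: powr_mult mult_ac)
    then have "J powr (1 / p) \<le> A powr (1 / p) * K powr (1 / q)"
      using pos by simp
    then have "(J powr (1 / p)) powr p \<le> (A powr (1 / p) * K powr (1 / q)) powr p"
      using pq by (intro powr_mono2) auto
    then show ?thesis
      using pq pq' nonneg pos by (simp add: powr_mult powr_powr mult.commute)
  qed
  then show ?thesis unfolding J_def A_def S_def .
qed

text \<open>
  The dual exponent \<open>q = p / (p - 1)\<close> satisfies \<open>1 / (q - 1) = p - 1\<close>.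
\<close>

lemma fourier_partial_sum_bound_ge_2:
  assumes "2 \<le> p" and f: "f \<in> borel_measurable X_space" "integrable X_space (\<lambda>x. cmod (f x) powr p)"
  shows "(LINT x|X_space. cmod (fourier_partial_sum M f x) powr p)
    \<le> (16 * (p - 1)) powr (p - 1) * (LINT x|X_space. cmod (f x) powr p)"
proof (rule fourier_partial_sum_duality[OF _ _ _ _ f])
  define q where "q = p / (p - 1)"
  show "1 < p" "1 < p / (p - 1)" "1 / p + 1 / (p / (p - 1)) = 1"
    using assms(1) by (auto simp: field_simps)
  have q: "1 < q" "q \<le> 2" "16 / (q - 1) = 16 * (p - 1)"
    using assms(1) by (auto simp: q_def field_simps)
  show "(LINT x|X_space. cmod (fourier_partial_sum M (\<lambda>x. k (cis x)) x) powr (p / (p - 1)))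
        \<le> 16 * (p - 1) * (LINT x|X_space. cmod (k (cis x)) powr (p / (p - 1)))"
    if "continuous_on (sphere 0 1) k" for k
    using fourier_partial_sum_bound_continuous[OF that q(1,2)] unfolding q(3) unfolding q_def .
qed

text \<open>
  The constant for the dual exponent \<open>q \<ge> 2\<close> is \<open>(16 (q - 1))\<^bsup>q-1\<^esup>\<close>, and duality raises it to the
  power \<open>p - 1\<close>, which undoes the exponent because \<open>(q - 1) (p - 1) = 1\<close>.
\<close>

lemma fourier_partial_sum_bound_le_2:
  assumes p: "1 < p" "p \<le> 2" and f: "f \<in> borel_measurable X_space" "integrable X_space (\<lambda>x. cmod (f x) powr p)"
  shows "(LINT x|X_space. cmod (fourier_partial_sum M f x) powr p)
    \<le> 16 / (p - 1) * (LINT x|X_space. cmod (f x) powr p)"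
proof -
  define q where "q = p / (p - 1)"
  have q: "2 \<le> q" "1 < q" "1 / p + 1 / q = 1" "(q - 1) * (p - 1) = 1" "16 * (q - 1) = 16 / (p - 1)"
    using p by (auto simp: q_def field_simps)
  have "(LINT x|X_space. cmod (fourier_partial_sum M f x) powr p)
    \<le> ((16 * (q - 1)) powr (q - 1)) powr (p - 1) * (LINT x|X_space. cmod (f x) powr p)"
  proof (rule fourier_partial_sum_duality[OF p(1) q(2,3) _ f])
    fix k :: "complex \<Rightarrow> complex" assume k: "continuous_on (sphere 0 1) k"
    have ck: "continuous_on UNIV (\<lambda>x. k (cis x))"
      by (rule continuous_on_compose2[OF k]) (auto intro!: continuous_intros)
    show "(LINT x|X_space. cmod (fourier_partial_sum M (\<lambda>x. k (cis x)) x) powr q)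
        \<le> (16 * (q - 1)) powr (q - 1) * (LINT x|X_space. cmod (k (cis x)) powr q)"
      using q(2) by (intro fourier_partial_sum_bound_ge_2 q(1) continuous_imp_measurable_X_space
         continuous_imp_integrable_X_space ck continuous_on_powr' continuous_on_norm continuous_intros) auto
  qed
  also have "((16 * (q - 1)) powr (q - 1)) powr (p - 1) = 16 / (p - 1)"
    using q p by (simp add: powr_powr)
  finally show ?thesis .
qed

text \<open>
  Both constants above are dominated by \<open>C\<^sup>p\<close> with \<open>C = 16 p\<^sup>2 / (p - 1)\<close>: each of them is a power
  with exponent at most \<open>p\<close> of a number bounded by \<open>C\<close>, and \<open>C \<ge> 1\<close>.
\<close>

lemma fourier_partial_sum_bound:
  assumes p: "1 < p" and f: "f \<in> borel_measurable X_space" "integrable X_space (\<lambda>x. cmod (f x) powr p)"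
  shows "(LINT x|X_space. cmod (fourier_partial_sum M f x) powr p)
    \<le> (16 * p\<^sup>2 / (p - 1)) powr p * (LINT x|X_space. cmod (f x) powr p)"
proof -
  define C where "C = 16 * p\<^sup>2 / (p - 1)"
  have A: "0 \<le> (LINT x|X_space. cmod (f x) powr p)" by simp
  have "p \<le> p\<^sup>2" using p by (simp add: power2_eq_square)
  then have p2: "p - 1 \<le> p\<^sup>2" "1 \<le> p\<^sup>2" using p by auto
  have "16 * (p - 1) * (p - 1) \<le> 16 * p\<^sup>2" using p by (simp add: power2_eq_square algebra_simps)
  then have C1: "1 \<le> C" "16 * (p - 1) \<le> C"
    using p p2 by (auto simp: C_def pos_le_divide_eq)
  have C2: "16 / (p - 1) \<le> C"
    unfolding C_def using p p2 by (intro divide_right_mono) auto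
  show ?thesis
  proof (cases "p \<le> 2")
    case True
    have "16 / (p - 1) \<le> C powr 1" using C1 C2 by simp
    also have "\<dots> \<le> C powr p" using C1 p by (intro powr_mono) auto
    finally have "16 / (p - 1) \<le> C powr p" .
    with fourier_partial_sum_bound_le_2[OF p True f, of M] mult_right_mono[OF this A]
    show ?thesis unfolding C_def by linarith
  next
    case False
    have "(16 * (p - 1)) powr (p - 1) \<le> C powr (p - 1)" using C1 p by (intro powr_mono2) auto
    also have "\<dots> \<le> C powr p" using C1 p by (intro powr_mono) auto
    finally have "(16 * (p - 1)) powr (p - 1) \<le> C powr p" .
    with fourier_partial_sum_bound_ge_2[OF _ f, of M] mult_right_mono[OF this A] False
    show ?thesis unfolding C_def by linarith
  qed
qed

section \<open>Boundedness between the spaces \<open>G(\<psi>)\<close>\<close>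

lemma Lp_norm_eq:
  assumes "integrable X_space (\<lambda>x. cmod (f x) powr p)"
  shows "Lp_norm p f = ennreal ((LINT x|X_space. cmod (f x) powr p) powr (1 / p))"
proof -
  have "(\<integral>\<^sup>+x. ennreal (cmod (f x) powr p) \<partial>X_space) = ennreal (LINT x|X_space. cmod (f x) powr p)"
    using assms by (intro nn_integral_eq_integral) auto
  then show ?thesis
    unfolding Lp_norm_def ennreal_powr_def by simp
qed

lemma Lp_norm_fourier_partial_sum_le:
  assumes p: "1 < p" and f: "f \<in> borel_measurable X_space" "Lp_norm p f < \<infinity>"
  shows "Lp_norm p (fourier_partial_sum M f) \<le> ennreal (16 * p\<^sup>2 / (p - 1)) * Lp_norm p f"
proof -
  define C where "C = 16 * p\<^sup>2 / (p - 1)"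
  have C: "0 \<le> C" using p by (simp add: C_def)
  have "(\<integral>\<^sup>+x. ennreal (cmod (f x) powr p) \<partial>X_space) < \<infinity>"
    using f(2) by (auto simp: Lp_norm_def ennreal_powr_def less_top split: if_splits)
  then have int: "integrable X_space (\<lambda>x. cmod (f x) powr p)"
    using f(1) by (intro integrableI_bounded) auto
  have int_S: "integrable X_space (\<lambda>x. cmod (fourier_partial_sum M f x) powr p)"
    using p by (intro continuous_imp_integrable_X_space continuous_on_powr' continuous_intros) auto
  have "(LINT x|X_space. cmod (fourier_partial_sum M f x) powr p) powr (1 / p)
    \<le> (C powr p * (LINT x|X_space. cmod (f x) powr p)) powr (1 / p)"
    using fourier_partial_sum_bound[OF p f(1) int] p unfolding C_def by (intro powr_mono2) auto
  also have "\<dots> = C * (LINT x|X_space. cmod (f x) powr p) powr (1 / p)"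
    using p C by (simp add: powr_mult powr_powr)
  finally show ?thesis
    unfolding Lp_norm_eq[OF int] Lp_norm_eq[OF int_S] C_def[symmetric]
    using C by (simp add: ennreal_leI flip: ennreal_mult)
qed

lemma einterval_1_infinity: "einterval 1 \<infinity> = {1<..}"
  by (auto simp: einterval_def one_ereal_def)

text \<open>
  Membership in \<open>G(\<psi>)\<close> and finiteness of \<open>\<psi>\<close> put \<open>f\<close> in every \<open>L\<^sup>p\<close>, and \<open>\<psi>\<^sub>1\<^sub>1(p) / \<psi>(p)\<close> cancels
  the growth of the \<open>L\<^sup>p\<close> constant for each \<open>p\<close> separately.
\<close>

lemma G_norm_fourier_partial_sum_le:
  assumes pos: "\<And>p. 1 < p \<Longrightarrow> 0 < \<psi> p" and fin: "\<And>p. 1 < p \<Longrightarrow> \<psi> p < \<infinity>"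
    and f: "f \<in> G_space 1 \<infinity> \<psi>"
  shows "G_norm 1 \<infinity> (psi_11 \<psi>) (fourier_partial_sum M f) \<le> 16 * G_norm 1 \<infinity> \<psi> f"
  unfolding G_norm_def[of _ _ "psi_11 \<psi>"] einterval_1_infinity
proof (rule SUP_least)
  fix p :: real assume "p \<in> {1<..}"
  then have p: "1 < p" by simp
  have meas: "f \<in> borel_measurable X_space" and G: "G_norm 1 \<infinity> \<psi> f < \<infinity>"
    using f by (auto simp: G_space_def)
  have le: "Lp_norm p f / \<psi> p \<le> G_norm 1 \<infinity> \<psi> f"
    unfolding G_norm_def einterval_1_infinity using p by (intro SUP_upper) auto
  have "Lp_norm p f < \<infinity>"
    using le_less_trans[OF le G] fin[OF p]
    by (cases "Lp_norm p f = \<infinity>") (auto simp: ennreal_top_divide top.not_eq_extremum split: if_splits)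
  from Lp_norm_fourier_partial_sum_le[OF p meas this]
  have "Lp_norm p (fourier_partial_sum M f) \<le> ennreal (16 * p\<^sup>2 / (p - 1)) * Lp_norm p f" .
  moreover obtain a where a: "0 \<le> a" "Lp_norm p f = ennreal a"
    using \<open>Lp_norm p f < \<infinity>\<close> by (cases "Lp_norm p f") auto
  moreover obtain s where s: "0 < s" "\<psi> p = ennreal s"
    using pos[OF p] fin[OF p] by (cases "\<psi> p") auto
  moreover have "psi_11 \<psi> p = ennreal (p\<^sup>2 * s / (p - 1))"
    using p s by (simp add: psi_11_def divide_ennreal flip: ennreal_mult)
  moreover have "ennreal (16 * p\<^sup>2 / (p - 1)) * ennreal a = ennreal (16 * p\<^sup>2 / (p - 1) * a)"
    using p a(1) by (intro ennreal_mult[symmetric]) auto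
  ultimately have "Lp_norm p (fourier_partial_sum M f) / psi_11 \<psi> p
    \<le> ennreal (16 * p\<^sup>2 / (p - 1) * a) / ennreal (p\<^sup>2 * s / (p - 1))"
    using p by (metis divide_right_mono_ennreal)
  also have "\<dots> = ennreal (16 * (a / s))"
  proof -
    have "16 * e / d * a / (e * s / d) = 16 * (a / s)" if "e \<noteq> 0" "d \<noteq> 0" for e d
      using that s(1) by (simp add: field_simps)
    from this[of "p\<^sup>2" "p - 1"] show ?thesis
      using p a s by (subst divide_ennreal) auto
  qed
  also have "\<dots> = 16 * (Lp_norm p f / \<psi> p)"
    using a s by (subst ennreal_mult) (auto simp: divide_ennreal)
  also have "\<dots> \<le> 16 * G_norm 1 \<infinity> \<psi> f" using le by (intro mult_left_mono) auto
  finally show "Lp_norm p (fourier_partial_sum M f) / psi_11 \<psi> p \<le> 16 * G_norm 1 \<infinity> \<psi> f" .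
qed

theorem theorem10:
  fixes \<psi> :: "real \<Rightarrow> ennreal"
  assumes "\<psi> \<in> U_Psi 1 \<infinity>"
    and "{1<..} \<subseteq> supp_Psi \<psi>"
  shows "(SUP M\<in>{1..}. G_op_norm 1 \<infinity> \<psi> (psi_11 \<psi>) (fourier_partial_sum M)) < \<infinity> \<and>
    (\<exists>C<\<infinity>. \<forall>M\<ge>1. \<forall>f\<in>G_space 1 \<infinity> \<psi>.
       G_norm 1 \<infinity> (psi_11 \<psi>) (fourier_partial_sum M f) \<le> C * G_norm 1 \<infinity> \<psi> f)"
proof -
  have pos: "0 < \<psi> p" if "1 < p" for p
    using assms(1) that by (auto simp: U_Psi_def einterval_1_infinity)
  have fin: "\<psi> p < \<infinity>" if "1 < p" for p
    using assms(2) that by (auto simp: supp_Psi_def)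
  have bound: "G_norm 1 \<infinity> (psi_11 \<psi>) (fourier_partial_sum M f) \<le> 16 * G_norm 1 \<infinity> \<psi> f"
    if "f \<in> G_space 1 \<infinity> \<psi>" for M f
    using G_norm_fourier_partial_sum_le[of \<psi> f M] pos fin that by blast
  have "G_norm 1 \<infinity> (psi_11 \<psi>) (fourier_partial_sum M f) / G_norm 1 \<infinity> \<psi> f \<le> 16"
    if f: "f \<in> G_space 1 \<infinity> \<psi>" for M f
  proof (cases "G_norm 1 \<infinity> \<psi> f = 0")
    case True
    then show ?thesis using bound[OF f, of M] by simp
  next
    case False
    have "G_norm 1 \<infinity> \<psi> f < \<infinity>" using f by (simp add: G_space_def)
    then obtain b where b: "0 < b" "G_norm 1 \<infinity> \<psi> f = ennreal b"
      using False by (cases "G_norm 1 \<infinity> \<psi> f") (auto simp: less_le)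
    have "G_norm 1 \<infinity> (psi_11 \<psi>) (fourier_partial_sum M f) / G_norm 1 \<infinity> \<psi> f
        \<le> (16 * G_norm 1 \<infinity> \<psi> f) / G_norm 1 \<infinity> \<psi> f"
      by (intro divide_right_mono_ennreal bound f)
    also have "\<dots> = 16"
      using b by (simp add: divide_ennreal flip: ennreal_numeral ennreal_mult)
    finally show ?thesis .
  qed
  then have "(SUP M\<in>{1..}. G_op_norm 1 \<infinity> \<psi> (psi_11 \<psi>) (fourier_partial_sum M)) \<le> 16"
    unfolding G_op_norm_def by (intro SUP_least)
  also have "(16 :: ennreal) < \<infinity>" by (simp add: less_top)
  finally show ?thesis
    using bound by (intro conjI exI[of _ 16]) (auto simp: less_top)
qed

end
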